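(* In the setting described in the context (a $3$-dimensional Calabi-Yau manifold $X$ with $T^2$-symmetry given by data $W$, $\alpha_1,\alpha_2$, and the special Lagrangian $3$-torus fibration $f:X\to B$), the semi-flat volumes function $\Phi:B\to\mathbb{R}$ of the fibration is $$\Phi=\frac{\det\left(\int_0^{\kappa}W^{-1}\,dx\right)}{\int_0^{\kappa}\det W^{-1}\,dx}.$$
   Context: Setting. Let $B\subseteq\mathbb{R}^3$ be open, let $u=x+iy$ be the coordinate on $\mathbb{C}$, let $S^1=\mathbb{R}/\mathbb{Z}$, and let $$\tilde X=\{(\phi_1,\phi_2,u,t_1,t_2)\in S^1\times S^1\times\mathbb{C}\times\mathbb{R}\times\mathbb{R}\;:\;(t_1,t_2,\operatorname{Im}u)\in B\}.$$ Let $T^2$ act on $\tilde X$ by translations of $(\phi_1,\phi_2)$. Let $W=(w_{jk})$ be a $2\times2$ positive definite symmetric matrix of real smooth functions, with inverse $W^{-1}=(w^{jk})$, and let $\alpha_1,\alpha_2$ be complex-valued smooth functions, all depending only on $(u,t_1,t_2)$ and all periodic in $x=\operatorname{Re}u$ with period $\kappa>0$. Put $$\theta_j=\alpha_j\,du-\overline{\alpha}_j\,d\overline{u}+i\,d\phi_j\quad(j=1,2),$$ $$\omega=\frac{i}{2}\det W^{-1}\,du\wedge d\overline{u}-i\sum_{j}\theta_j\wedge dt_j,\qquad \Omega=-\Big(\sum_k w^{1k}dt_k-\theta_1\Big)\wedge\Big(\sum_k w^{2k}dt_k-\theta_2\Big)\wedge du .$$ It is assumed that $(\Omega,\omega)$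 is a Calabi-Yau structure on $\tilde X$: $\Omega$ and $\omega$ are closed, $\Omega$ is a nowhere vanishing holomorphic $3$-form for the complex structure it determines, and $\omega$ is a Ricci-flat Kähler form with $\omega^{3}/3!=(-1)^{3}(i/2)^{3}\,\Omega\wedge\overline{\Omega}$. (This is the general local form of a $3$-dimensional Calabi-Yau structure with $T^2$-action that is Hamiltonian with moment map $(t_1,t_2)$ and preserves $\Omega$, and with reduced holomorphic $1$-form $du$.) Let $X=\tilde X/\kappa\mathbb{Z}$, where $\kappa\mathbb{Z}$ acts by translations on $x$; $(\Omega,\omega)$ descends to a Calabi-Yau structure on $X$. The map $$f:X\to B,\qquad f(\phi_1,\phi_2,u,t_1,t_2)=(t_1,t_2,\operatorname{Im}u)$$ is a special Lagrangian $3$-torus fibration ($\omega$ and $\operatorname{Im}\Omega$ restrict to zero on the fibres). Write $F_b=f^{-1}(b)$. For $b\in B$ let $\Sigma_1,\Sigma_2,\Sigma_3$ be the basis of $H_1(F_b,\mathbb{Z})$ represented by the $1$-cycles $\{x=\phi_2=0\}$, $\{x=\phi_1=0\}$, $\{\phi_1=\phi_2=0\}$ respectively. Semi-flat volumes function: for $b\in B$ let $\vartheta_1,\vartheta_2,\vartheta_3$ be the basis of harmonic $1$-forms on $F_b$ (for the metric induced by the Kähler metric of $X$) whose period matrix $\left(\int_{\Sigma_i}\vartheta_j\right)_{ij}$ is the identity; then $\Phi(b)=\det\left(\langle\vartheta_i,\vartheta_j\rangle\right)$, where $\langle\vartheta,\vartheta'\rangle=\int_{F_b}\vartheta\wedge\star\vartheta'$.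 The integral of a matrix is taken entrywise, and the integrals over $x$ are taken at fixed $(t_1,t_2,y)=b$. *)

theory Defs
  imports "HOL-Analysis.Analysis"
begin

section \<open>Smooth maps and differential forms on open subsets of a Euclidean space\<close>

primrec Ck_on ::
    "nat \<Rightarrow> 'a::euclidean_space set \<Rightarrow> ('a \<Rightarrow> 'b::real_normed_vector) \<Rightarrow> bool" where
  "Ck_on 0 S f \<longleftrightarrow> continuous_on S f"
| "Ck_on (Suc n) S f \<longleftrightarrow>
     (\<forall>x\<in>S. f differentiable at x) \<and> (\<forall>v. Ck_on n S (\<lambda>x. frechet_derivative f (at x) v))"

definition smooth_on :: "'a::euclidean_space set \<Rightarrow> ('a \<Rightarrow> 'b::real_normed_vector) \<Rightarrow> bool" where
  "smooth_on S f \<longleftrightarrow> (\<forall>n. Ck_on n S f)"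

text \<open>A \<open>k\<close>-form \<open>a\<close> sends a point \<open>z\<close> and tangent vectors \<open>v 0, \<dots>, v (k - 1)\<close> to the scalar
  \<open>a z v\<close>; \<open>alternating_map\<close> forces the value not to depend on \<open>v i\<close> for \<open>i \<ge> k\<close>.\<close>

type_synonym ('a, 'b) form = "'a \<Rightarrow> (nat \<Rightarrow> 'a) \<Rightarrow> 'b"

definition alternating_map ::
    "nat \<Rightarrow> ((nat \<Rightarrow> 'a::euclidean_space) \<Rightarrow> 'b::real_normed_field) \<Rightarrow> bool" where
  "alternating_map k A \<longleftrightarrow>
     (\<forall>v w. (\<forall>i<k. v i = w i) \<longrightarrow> A v = A w) \<and>
     (\<forall>v. \<forall>i<k. linear (\<lambda>x. A (v(i := x)))) \<and>
     (\<forall>v i j. i < j \<and> j < k \<and> v i = v j \<longrightarrow> A v = 0)"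

definition differential_form ::
    "nat \<Rightarrow> 'a::euclidean_space set \<Rightarrow> ('a, 'b::real_normed_field) form \<Rightarrow> bool" where
  "differential_form k U a \<longleftrightarrow>
     (\<forall>z\<in>U. alternating_map k (a z)) \<and> (\<forall>v. smooth_on U (\<lambda>z. a z v))"

text \<open>Normalised so that \<open>(dx \<and> dy) (\<partial>\<^sub>x, \<partial>\<^sub>y) = 1\<close>.\<close>

definition wedge :: "nat \<Rightarrow> nat \<Rightarrow> ('a::euclidean_space, 'b::real_normed_field) form
    \<Rightarrow> ('a, 'b) form \<Rightarrow> ('a, 'b) form" where
  "wedge p q a b z v =
     (\<Sum>\<pi> | \<pi> permutes {..<p + q}.
        of_int (sign \<pi>) * a z (\<lambda>i. v (\<pi> i)) * b z (\<lambda>i. v (\<pi> (p + i)))) / (fact p * fact q)"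

definition ext_d :: "nat \<Rightarrow> ('a::euclidean_space, 'b::real_normed_field) form \<Rightarrow> ('a, 'b) form" where
  "ext_d k a z v =
     (\<Sum>i\<le>k. (-1) ^ i *
        frechet_derivative (\<lambda>y. a y (\<lambda>j. if j < i then v j else v (Suc j))) (at z) (v i))"


section \<open>Riemannian metrics\<close>

type_synonym 'a metric = "'a \<Rightarrow> 'a \<Rightarrow> 'a \<Rightarrow> real"

text \<open>Levi-Civita derivative \<open>\<nabla>\<^sub>v w\<close> of the constant vector field \<open>w\<close>, by the Koszul formula.\<close>

definition christoffel :: "'a::euclidean_space metric \<Rightarrow> 'a \<Rightarrow> 'a \<Rightarrow> 'a \<Rightarrow> 'a" where
  "christoffel g z v w =
     (THE c. \<forall>x. 2 * g z c x =
        frechet_derivative (\<lambda>y. g y w x) (at z) v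
      + frechet_derivative (\<lambda>y. g y v x) (at z) w
      - frechet_derivative (\<lambda>y. g y v w) (at z) x)"

definition riemann :: "'a::euclidean_space metric \<Rightarrow> 'a \<Rightarrow> 'a \<Rightarrow> 'a \<Rightarrow> 'a \<Rightarrow> 'a" where
  "riemann g z u v w =
     frechet_derivative (\<lambda>y. christoffel g y v w) (at z) u
   - frechet_derivative (\<lambda>y. christoffel g y u w) (at z) v
   + christoffel g z u (christoffel g z v w)
   - christoffel g z v (christoffel g z u w)"

definition ricci :: "'a::euclidean_space metric \<Rightarrow> 'a \<Rightarrow> 'a \<Rightarrow> 'a \<Rightarrow> real" where
  "ricci g z v w = (\<Sum>e\<in>Basis. riemann g z e v w \<bullet> e)"

definition pullback_metric ::
    "('a::euclidean_space \<Rightarrow> 'b::euclidean_space) \<Rightarrow> 'b metric \<Rightarrow> 'a metric" where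
  "pullback_metric f g p v w =
     g (f p) (frechet_derivative f (at p) v) (frechet_derivative f (at p) w)"


section \<open>Calabi-Yau structures in complex dimension 3\<close>

text \<open>The endomorphism \<open>J\<close> determined by \<open>\<Omega>\<close>: the vectors \<open>v + i J v\<close> (of type \<open>(0,1)\<close>) are those
  annihilated by \<open>\<Omega>\<close>.\<close>

definition cstruct :: "('a::euclidean_space, complex) form \<Rightarrow> 'a \<Rightarrow> 'a \<Rightarrow> 'a" where
  "cstruct \<Omega> z v = (THE w. \<forall>x. \<Omega> z (x(0 := w)) = \<i> * \<Omega> z (x(0 := v)))"

text \<open>The last two conjuncts say that \<open>J\<close> is smooth and that its Nijenhuis tensor
  \<open>[Jv, Jw] - J [Jv, w] - J [v, Jw] - [v, w]\<close> vanishes (evaluated on constant fields).\<close>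

definition complex_structure :: "'a::euclidean_space set \<Rightarrow> ('a \<Rightarrow> 'a \<Rightarrow> 'a) \<Rightarrow> bool" where
  "complex_structure U J \<longleftrightarrow>
     (\<forall>z\<in>U. linear (J z) \<and> (\<forall>v. J z (J z v) = - v)) \<and>
     (\<forall>v. smooth_on U (\<lambda>z. J z v)) \<and>
     (\<forall>z\<in>U. \<forall>v w.
        frechet_derivative (\<lambda>y. J y w) (at z) (J z v)
      - frechet_derivative (\<lambda>y. J y v) (at z) (J z w)
      + J z (frechet_derivative (\<lambda>y. J y v) (at z) w)
      - J z (frechet_derivative (\<lambda>y. J y w) (at z) v) = 0)"

text \<open>A \<open>k\<close>-form \<open>a\<close> of type \<open>(k,0)\<close> with \<open>\<partial>bar a = 0\<close>; the latter says that contracting \<open>da\<close>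
  with a vector \<open>v + i J v\<close> gives zero.\<close>

definition holomorphic_form :: "nat \<Rightarrow> 'a::euclidean_space set \<Rightarrow> ('a \<Rightarrow> 'a \<Rightarrow> 'a)
    \<Rightarrow> ('a, complex) form \<Rightarrow> bool" where
  "holomorphic_form k U J a \<longleftrightarrow>
     differential_form k U a \<and>
     (\<forall>z\<in>U. \<forall>v x. \<forall>i<k. a z (x(i := J z v)) = \<i> * a z (x(i := v))) \<and>
     (\<forall>z\<in>U. \<forall>v x. ext_d k a z (x(0 := v)) + \<i> * ext_d k a z (x(0 := J z v)) = 0)"

definition kaehler_metric ::
    "('a::euclidean_space \<Rightarrow> 'a \<Rightarrow> 'a) \<Rightarrow> ('a, complex) form \<Rightarrow> 'a metric" where
  "kaehler_metric J \<omega> z v w = Re (\<omega> z ((!) [v, J z w]))"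

definition kaehler_form :: "'a::euclidean_space set \<Rightarrow> ('a \<Rightarrow> 'a \<Rightarrow> 'a)
    \<Rightarrow> ('a, complex) form \<Rightarrow> bool" where
  "kaehler_form U J \<omega> \<longleftrightarrow>
     differential_form 2 U \<omega> \<and>
     (\<forall>z\<in>U. \<forall>x. \<omega> z x \<in> \<real>) \<and>
     (\<forall>z\<in>U. \<forall>x. ext_d 2 \<omega> z x = 0) \<and>
     (\<forall>z\<in>U. \<forall>v w. \<omega> z ((!) [J z v, J z w]) = \<omega> z ((!) [v, w])) \<and>
     (\<forall>z\<in>U. \<forall>v. v \<noteq> 0 \<longrightarrow> kaehler_metric J \<omega> z v v > 0)"

definition calabi_yau :: "'a::euclidean_space set \<Rightarrow> ('a, complex) form
    \<Rightarrow> ('a, complex) form \<Rightarrow> bool" where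
  "calabi_yau U \<Omega> \<omega> \<longleftrightarrow>
     DIM('a) = 6 \<and> open U \<and>
     complex_structure U (cstruct \<Omega>) \<and>
     holomorphic_form 3 U (cstruct \<Omega>) \<Omega> \<and>
     (\<forall>z\<in>U. \<exists>x. \<Omega> z x \<noteq> 0) \<and>
     (\<forall>z\<in>U. \<forall>x. ext_d 3 \<Omega> z x = 0) \<and>
     kaehler_form U (cstruct \<Omega>) \<omega> \<and>
     (\<forall>z\<in>U. \<forall>v w. ricci (kaehler_metric (cstruct \<Omega>) \<omega>) z v w = 0) \<and>
     (\<forall>z\<in>U. \<forall>x. wedge 4 2 (wedge 2 2 \<omega> \<omega>) \<omega> z x / fact 3
        = (-1) ^ 3 * (\<i> / 2) ^ 3 * wedge 3 3 \<Omega> (\<lambda>z x. cnj (\<Omega> z x)) z x)"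


section \<open>The manifold with its \<open>T\<^sup>2\<close>-symmetric forms\<close>

text \<open>\<open>\<phi>\<close> takes values in \<open>\<real>/\<int>\<close> and \<open>x = Re u\<close> in \<open>\<real>/\<kappa>\<int>\<close>.  A tensor field on the quotient manifold is
  an invariant tensor field on its covering space, whose points are \<open>(\<phi>, u, t)\<close>.  Points of
  the base are written \<open>(t, y)\<close> with \<open>y = Im u\<close>.\<close>

type_synonym cover = "(real ^ 2) \<times> complex \<times> (real ^ 2)"

type_synonym base = "(real ^ 2) \<times> real"

definition fibration :: "cover \<Rightarrow> base" where
  "fibration = (\<lambda>(\<phi>, u, t). (t, Im u))"

definition total_space :: "base set \<Rightarrow> cover set" where
  "total_space B = fibration -` B"

definition data_domain :: "base set \<Rightarrow> (complex \<times> (real ^ 2)) set" where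
  "data_domain B = {(u, t). (t, Im u) \<in> B}"

definition d_phi :: "2 \<Rightarrow> (cover, complex) form" where
  "d_phi j z v = complex_of_real (fst (v 0) $ j)"

definition d_u :: "(cover, complex) form" where
  "d_u z v = fst (snd (v 0))"

definition d_ubar :: "(cover, complex) form" where
  "d_ubar z v = cnj (fst (snd (v 0)))"

definition d_t :: "2 \<Rightarrow> (cover, complex) form" where
  "d_t j z v = complex_of_real (snd (snd (v 0)) $ j)"

definition theta :: "(complex \<times> (real ^ 2) \<Rightarrow> complex ^ 2) \<Rightarrow> 2 \<Rightarrow> (cover, complex) form" where
  "theta \<alpha> j z v =
     \<alpha> (snd z) $ j * d_u z v - cnj (\<alpha> (snd z) $ j) * d_ubar z v + \<i> * d_phi j z v"

definition omega_form :: "(complex \<times> (real ^ 2) \<Rightarrow> real ^ 2 ^ 2)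
    \<Rightarrow> (complex \<times> (real ^ 2) \<Rightarrow> complex ^ 2) \<Rightarrow> (cover, complex) form" where
  "omega_form W \<alpha> z v =
     \<i> / 2 * complex_of_real (det (matrix_inv (W (snd z)))) * wedge 1 1 d_u d_ubar z v
   - \<i> * (\<Sum>j\<in>UNIV. wedge 1 1 (theta \<alpha> j) (d_t j) z v)"

definition zeta :: "(complex \<times> (real ^ 2) \<Rightarrow> real ^ 2 ^ 2)
    \<Rightarrow> (complex \<times> (real ^ 2) \<Rightarrow> complex ^ 2) \<Rightarrow> 2 \<Rightarrow> (cover, complex) form" where
  "zeta W \<alpha> j z v =
     (\<Sum>k\<in>UNIV. complex_of_real (matrix_inv (W (snd z)) $ j $ k) * d_t k z v) - theta \<alpha> j z v"

definition Omega_form :: "(complex \<times> (real ^ 2) \<Rightarrow> real ^ 2 ^ 2)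
    \<Rightarrow> (complex \<times> (real ^ 2) \<Rightarrow> complex ^ 2) \<Rightarrow> (cover, complex) form" where
  "Omega_form W \<alpha> z v = - wedge 2 1 (wedge 1 1 (zeta W \<alpha> 1) (zeta W \<alpha> 2)) d_u z v"


section \<open>Hodge theory on a 3-torus\<close>

text \<open>Forms on \<open>\<real>\<^sup>3\<close> modulo the lattice \<open>\<int> \<times> \<int> \<times> \<kappa>\<int>\<close> are lattice-periodic forms on \<open>\<real>\<^sup>3\<close>.  The
  coordinates are \<open>(\<phi>\<^sub>1, \<phi>\<^sub>2, x)\<close>, in the orientation \<open>d\<phi>\<^sub>1 \<and> d\<phi>\<^sub>2 \<and> dx\<close>.\<close>

definition period :: "real \<Rightarrow> 3 \<Rightarrow> real ^ 3" where
  "period \<kappa> i = axis i (if i = 3 then \<kappa> else 1)"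

definition torus_form :: "real \<Rightarrow> nat \<Rightarrow> (real ^ 3, real) form \<Rightarrow> bool" where
  "torus_form \<kappa> k a \<longleftrightarrow> differential_form k UNIV a \<and> (\<forall>i p. a (p + period \<kappa> i) = a p)"

definition gram :: "(real ^ 3) metric \<Rightarrow> real ^ 3 \<Rightarrow> real ^ 3 ^ 3" where
  "gram g p = (\<chi> i j. g p (axis i 1) (axis j 1))"

definition volume_form :: "(real ^ 3) metric \<Rightarrow> (real ^ 3, real) form" where
  "volume_form g p v = sqrt (det (gram g p)) * det (vector [v 0, v 1, v 2] :: real ^ 3 ^ 3)"

text \<open>With \<open>e\<^sub>i\<close> the coordinate fields and \<open>e\<^sup>i\<close> the metrically dual fields (the rows of the
  inverse Gram matrix),
  \<open>(\<star>a) (v, \<dots>) = 1/k! * \<Sum> a (e\<^sub>i, e\<^sub>j, \<dots>) vol (e\<^sup>i, e\<^sup>j, \<dots>, v, \<dots>)\<close>,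
  so that \<open>b \<and> \<star>a = \<langle>b, a\<rangle> vol\<close>.\<close>

definition hodge_star ::
    "nat \<Rightarrow> (real ^ 3) metric \<Rightarrow> (real ^ 3, real) form \<Rightarrow> (real ^ 3, real) form" where
  "hodge_star k g a p v =
     (\<Sum>I \<in> {..<k} \<rightarrow>\<^sub>E (UNIV :: 3 set).
        a p (\<lambda>i. axis (I i) 1) *
        volume_form g p (\<lambda>i. if i < k then matrix_inv (gram g p) $ I i else v (i - k))) / fact k"

text \<open>The sign \<open>(-1)\<^sup>k\<close> is \<open>(-1) ^ (n (k + 1) + 1)\<close> for \<open>n = 3\<close>.\<close>

definition codiff ::
    "nat \<Rightarrow> (real ^ 3) metric \<Rightarrow> (real ^ 3, real) form \<Rightarrow> (real ^ 3, real) form" where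
  "codiff k g a p v =
     (-1) ^ k * hodge_star (4 - k) g (ext_d (3 - k) (hodge_star k g a)) p v"

definition hodge_laplacian ::
    "nat \<Rightarrow> (real ^ 3) metric \<Rightarrow> (real ^ 3, real) form \<Rightarrow> (real ^ 3, real) form" where
  "hodge_laplacian k g a p v =
     (if k = 0 then 0 else ext_d (k - 1) (codiff k g a) p v) + codiff (k + 1) g (ext_d k a) p v"

definition harmonic_1form :: "real \<Rightarrow> (real ^ 3) metric \<Rightarrow> (real ^ 3, real) form \<Rightarrow> bool" where
  "harmonic_1form \<kappa> g \<theta> \<longleftrightarrow> torus_form \<kappa> 1 \<theta> \<and> (\<forall>p v. hodge_laplacian 1 g \<theta> p v = 0)"

definition harmonic_basis ::
    "real \<Rightarrow> (real ^ 3) metric \<Rightarrow> (3 \<Rightarrow> (real ^ 3, real) form) \<Rightarrow> bool" where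
  "harmonic_basis \<kappa> g \<theta> \<longleftrightarrow>
     (\<forall>i. harmonic_1form \<kappa> g (\<theta> i)) \<and>
     (\<forall>\<eta>. harmonic_1form \<kappa> g \<eta> \<longrightarrow>
        (\<exists>!c :: real ^ 3. \<eta> = (\<lambda>p v. \<Sum>i\<in>UNIV. c $ i * \<theta> i p v)))"

definition cycle :: "real \<Rightarrow> 3 \<Rightarrow> real \<Rightarrow> real ^ 3" where
  "cycle \<kappa> i s = s *\<^sub>R period \<kappa> i"

definition path_integral :: "(real \<Rightarrow> real ^ 3) \<Rightarrow> (real ^ 3, real) form \<Rightarrow> real" where
  "path_integral \<gamma> \<theta> = integral {0..1} (\<lambda>s. \<theta> (\<gamma> s) (\<lambda>_. vector_derivative \<gamma> (at s)))"

definition period_matrix :: "real \<Rightarrow> (3 \<Rightarrow> (real ^ 3, real) form) \<Rightarrow> real ^ 3 ^ 3" where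
  "period_matrix \<kappa> \<theta> = (\<chi> i j. path_integral (cycle \<kappa> i) (\<theta> j))"

definition torus_integral :: "real \<Rightarrow> (real ^ 3, real) form \<Rightarrow> real" where
  "torus_integral \<kappa> a =
     integral (cbox 0 (\<Sum>i\<in>UNIV. period \<kappa> i)) (\<lambda>p. a p ((!) [axis 1 1, axis 2 1, axis 3 1]))"

definition L2_inner :: "real \<Rightarrow> (real ^ 3) metric
    \<Rightarrow> (real ^ 3, real) form \<Rightarrow> (real ^ 3, real) form \<Rightarrow> real" where
  "L2_inner \<kappa> g \<theta> \<theta>' = torus_integral \<kappa> (wedge 1 2 \<theta> (hodge_star 1 g \<theta>'))"

definition dual_harmonic_basis ::
    "real \<Rightarrow> (real ^ 3) metric \<Rightarrow> 3 \<Rightarrow> (real ^ 3, real) form" where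
  "dual_harmonic_basis \<kappa> g =
     (THE \<theta>. harmonic_basis \<kappa> g \<theta> \<and> period_matrix \<kappa> \<theta> = mat 1)"

definition harmonic_volume :: "real \<Rightarrow> (real ^ 3) metric \<Rightarrow> real" where
  "harmonic_volume \<kappa> g =
     (let \<theta> = dual_harmonic_basis \<kappa> g
      in det (\<chi> i j. L2_inner \<kappa> g (\<theta> i) (\<theta> j) :: real ^ 3 ^ 3))"


section \<open>The semi-flat volumes function\<close>

definition fibre_chart :: "base \<Rightarrow> real ^ 3 \<Rightarrow> cover" where
  "fibre_chart b p = (vector [p $ 1, p $ 2], Complex (p $ 3) (snd b), fst b)"

lemma inj_fibre_chart: "inj (fibre_chart b)"
proof (rule injI)
  fix p q assume eq: "fibre_chart b p = fibre_chart b q"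
  have "(vector [p $ 1, p $ 2] :: real ^ 2) $ i = vector [q $ 1, q $ 2] $ i" for i
    using eq by (simp add: fibre_chart_def)
  from this[of 1] this[of 2] show "p = q"
    using eq by (simp add: fibre_chart_def vec_eq_iff forall_3)
qed

lemma range_fibre_chart: "range (fibre_chart b) = fibration -` {b}"
proof (intro equalityI subsetI)
  fix z assume "z \<in> fibration -` {b}"
  moreover obtain \<phi> u t where z: "z = (\<phi>, u, t)" by (cases z)
  ultimately have "z = fibre_chart b (vector [\<phi> $ 1, \<phi> $ 2, Re u])"
    by (auto simp: fibration_def fibre_chart_def vec_eq_iff forall_2)
  then show "z \<in> range (fibre_chart b)" by blast
qed (auto simp: fibration_def fibre_chart_def)

definition semi_flat_volumes :: "(complex \<times> (real ^ 2) \<Rightarrow> real ^ 2 ^ 2)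
    \<Rightarrow> (complex \<times> (real ^ 2) \<Rightarrow> complex ^ 2) \<Rightarrow> real \<Rightarrow> base \<Rightarrow> real" where
  "semi_flat_volumes W \<alpha> \<kappa> b =
     harmonic_volume \<kappa>
       (pullback_metric (fibre_chart b)
          (kaehler_metric (cstruct (Omega_form W \<alpha>)) (omega_form W \<alpha>)))"

end

theory Submission
  imports Defs
begin

text \<open>
  On a fibre the tangent vectors satisfy \<open>dt = 0\<close> and \<open>dy = 0\<close>.  Writing \<open>\<theta>\<^sub>j = i \<beta>\<^sub>j\<close>, so that
  \<open>\<beta>\<^sub>j = d\<phi>\<^sub>j + a\<^sub>j dx\<close> with \<open>a\<^sub>j = 2 Im \<alpha>\<^sub>j\<close> on the fibre, the complex structure of \<open>\<Omega>\<close> turns the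
  Kaehler metric into
  \<open>g = det W\<^sup>-\<^sup>1 dx\<^sup>2 + \<beta>\<^sup>T W \<beta>\<close> (\<open>kaehler_metric_fibre\<close>).  The determinant of its Gram matrix is
  \<open>det W\<^sup>-\<^sup>1 det W = 1\<close>, and its coefficients depend on \<open>x\<close> alone.

  Because the volume form is \<open>d\<phi>\<^sub>1 \<and> d\<phi>\<^sub>2 \<and> dx\<close>, Hodge theory on the fibre is vector calculus: a
  1-form \<open>\<eta>\<close> is closed if its curl vanishes, and coclosed if the divergence of the field \<open>X\<close> that
  results from raising its index vanishes.  Integrating by parts over the torus, harmonic 1-forms are closed and coclosed
  (\<open>harmonic_imp_closed_coclosed\<close>).  Each circle direction \<open>\<phi>\<^sub>j\<close> is a symmetry, and the
  component \<open>\<eta>\<^sub>j\<close> of a closed and coclosed form is then a harmonic function on the torus: its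
  gradient is the derivative of \<open>\<eta>\<close> in direction \<open>\<phi>\<^sub>j\<close>, again a coclosed form.  So \<open>\<eta>\<^sub>1 = c\<^sub>1\<close>
  and \<open>\<eta>\<^sub>2 = c\<^sub>2\<close> are constant (\<open>killing_component_constant\<close>), and what remains of the two
  equations says that the flux \<open>X\<^sub>3 = c\<^sub>3\<close> is constant too.  Hence the harmonic 1-forms are exactly
  \<open>c\<^sub>1 d\<phi>\<^sub>1 + c\<^sub>2 d\<phi>\<^sub>2 + (c\<^sub>3 det W\<^sup>-\<^sup>1 + a\<^sub>1 c\<^sub>1 + a\<^sub>2 c\<^sub>2) dx\<close> (\<open>harmonic_1form_iff\<close>).

  With \<open>D = \<integral> det W\<^sup>-\<^sup>1 dx\<close>, \<open>A = \<integral> a dx\<close> and \<open>M = \<integral> W\<^sup>-\<^sup>1 dx\<close>, the periods of this form are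
  \<open>c\<^sub>1\<close>, \<open>c\<^sub>2\<close> and \<open>c\<^sub>3 D + A \<bullet> (c\<^sub>1, c\<^sub>2)\<close>, while its square norm is
  \<open>(c\<^sub>1, c\<^sub>2)\<^sup>T M (c\<^sub>1, c\<^sub>2) + D c\<^sub>3\<^sup>2\<close>.  In the coordinates \<open>(c\<^sub>1, c\<^sub>2, c\<^sub>3)\<close> the \<open>L\<^sup>2\<close> product thus
  has determinant \<open>D det M\<close>; passing to the coordinates given by the periods, a triangular change
  of determinant \<open>D\<close>, divides it by \<open>D\<^sup>2\<close> and leaves \<open>det M / D\<close> (\<open>harmonic_volume_eq\<close>).
\<close>


section \<open>Smooth functions on a Euclidean space\<close>

lemma Ck_on_SucD: "Ck_on (Suc n) S f \<Longrightarrow> Ck_on n S f"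
proof (induction n arbitrary: f)
  case 0
  then show ?case
    by (auto intro!: continuous_at_imp_continuous_on differentiable_imp_continuous_within)
next
  case (Suc n)
  then show ?case by (metis Ck_on.simps(2))
qed

lemma frechet_derivative_plus:
  assumes "f differentiable at p" "g differentiable at p"
  shows "frechet_derivative (\<lambda>p. f p + g p) (at p) v =
         frechet_derivative f (at p) v + frechet_derivative g (at p) v"
proof -
  have "((\<lambda>p. f p + g p) has_derivative
      (\<lambda>v. frechet_derivative f (at p) v + frechet_derivative g (at p) v)) (at p)"
    using assms by (intro has_derivative_add) (simp_all add: frechet_derivative_works[symmetric])
  from frechet_derivative_at[OF this, symmetric] show ?thesis by simp
qed

lemma frechet_derivative_times:
  fixes f g :: "'a::euclidean_space \<Rightarrow> real"
  assumes "f differentiable at p" "g differentiable at p"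
  shows "frechet_derivative (\<lambda>p. f p * g p) (at p) v =
         f p * frechet_derivative g (at p) v + frechet_derivative f (at p) v * g p"
proof -
  have "((\<lambda>p. f p * g p) has_derivative
      (\<lambda>v. f p * frechet_derivative g (at p) v + frechet_derivative f (at p) v * g p)) (at p)"
    using assms by (intro has_derivative_mult) (simp_all add: frechet_derivative_works[symmetric])
  from frechet_derivative_at[OF this, symmetric] show ?thesis by simp
qed

lemma frechet_derivative_inverse:
  fixes f :: "'a::euclidean_space \<Rightarrow> real"
  assumes "f differentiable at p" "f p \<noteq> 0"
  shows "frechet_derivative (\<lambda>p. inverse (f p)) (at p) v =
         - (frechet_derivative f (at p) v * (inverse (f p) * inverse (f p)))"
proof -
  have "((\<lambda>p. inverse (f p)) has_derivative
      (\<lambda>v. - (inverse (f p) * frechet_derivative f (at p) v * inverse (f p)))) (at p)"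
    using assms by (intro Deriv.has_derivative_inverse) (simp_all add: frechet_derivative_works[symmetric])
  from frechet_derivative_at[OF this, symmetric] show ?thesis by simp
qed

text \<open>An affine map inside and a linear map outside: this is how functions of \<open>(u, t)\<close>, given
  only over the base, are restricted to a line in a fibre, and how their components are taken.\<close>

lemma frechet_derivative_affine:
  fixes f :: "'a::euclidean_space \<Rightarrow> 'b::real_normed_vector"
  assumes l: "bounded_linear l" and A: "bounded_linear A"
    and f: "f differentiable at (A p + c)"
  shows "(\<lambda>p. l (f (A p + c))) differentiable at p"
    and "frechet_derivative (\<lambda>p. l (f (A p + c))) (at p) v
           = l (frechet_derivative f (at (A p + c)) (A v))"
proof -
  have *: "((\<lambda>p. l (f (A p + c))) has_derivative
      (\<lambda>v. l (frechet_derivative f (at (A p + c)) (A v)))) (at p)"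
  proof (rule bounded_linear.has_derivative[OF l])
    have "((\<lambda>p. A p + c) has_derivative A) (at p)"
      using has_derivative_add[OF bounded_linear_imp_has_derivative[OF A] has_derivative_const] by simp
    from has_derivative_compose[OF this f[unfolded frechet_derivative_works]]
    show "((\<lambda>p. f (A p + c)) has_derivative
        (\<lambda>v. frechet_derivative f (at (A p + c)) (A v))) (at p)" by (simp add: o_def)
  qed
  show "(\<lambda>p. l (f (A p + c))) differentiable at p"
    using * by (auto simp: differentiable_def)
  show "frechet_derivative (\<lambda>p. l (f (A p + c))) (at p) v
           = l (frechet_derivative f (at (A p + c)) (A v))"
    using frechet_derivative_at[OF *, symmetric] by simp
qed

lemma Ck_on_const: "Ck_on n UNIV (\<lambda>p. c)"
  by (induction n arbitrary: c) auto

lemma Ck_on_add: "Ck_on n UNIV f \<Longrightarrow> Ck_on n UNIV g \<Longrightarrow> Ck_on n UNIV (\<lambda>p. f p + g p)"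
  by (induction n arbitrary: f g)
    (auto simp: frechet_derivative_plus intro: continuous_on_add)

lemma Ck_on_mult:
  fixes f g :: "'a::euclidean_space \<Rightarrow> real"
  shows "Ck_on n UNIV f \<Longrightarrow> Ck_on n UNIV g \<Longrightarrow> Ck_on n UNIV (\<lambda>p. f p * g p)"
proof (induction n arbitrary: f g)
  case 0
  then show ?case by (auto intro: continuous_on_mult)
next
  case (Suc n)
  have "Ck_on n UNIV f" "Ck_on n UNIV g"
    using Suc.prems Ck_on_SucD by blast+
  with Suc show ?case
    by (auto simp: frechet_derivative_times intro!: Ck_on_add Suc.IH)
qed

lemma Ck_on_minus:
  fixes f :: "'a::euclidean_space \<Rightarrow> real"
  shows "Ck_on n UNIV f \<Longrightarrow> Ck_on n UNIV (\<lambda>p. - f p)"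
  using Ck_on_mult[OF Ck_on_const[of n "-1"], of f] by simp

lemma Ck_on_inverse:
  fixes f :: "'a::euclidean_space \<Rightarrow> real"
  assumes "\<And>p. f p \<noteq> 0"
  shows "Ck_on n UNIV f \<Longrightarrow> Ck_on n UNIV (\<lambda>p. inverse (f p))"
proof (induction n)
  case 0
  then show ?case using assms by (auto intro: continuous_on_inverse)
next
  case (Suc n)
  have "Ck_on n UNIV (\<lambda>p. inverse (f p))"
    using Suc Ck_on_SucD by blast
  moreover have "Ck_on n UNIV (\<lambda>p. frechet_derivative f (at p) v)" for v
    using Suc.prems by simp
  moreover have "(\<lambda>p. inverse (f p)) differentiable at p" for p
    using Suc.prems assms by (intro differentiable_inverse) auto
  ultimately show ?case
    using Suc.prems assms by (simp add: frechet_derivative_inverse Ck_on_minus Ck_on_mult)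
qed

text \<open>The derivatives of the composite involve those of \<open>f\<close> at points of \<open>S\<close> only, so that \<open>S\<close>
  may be any set that contains the image of the affine map.\<close>

lemma Ck_on_affine:
  fixes f :: "'a::euclidean_space \<Rightarrow> 'b::real_normed_vector"
  assumes l: "bounded_linear l" and A: "bounded_linear A"
    and S: "\<And>p. A p + c \<in> S"
  shows "Ck_on n S f \<Longrightarrow> Ck_on n UNIV (\<lambda>p. l (f (A p + c)))"
proof (induction n arbitrary: f)
  case 0
  have "continuous_on UNIV (\<lambda>p. A p + c)"
    using A by (intro continuous_intros linear_continuous_on)
  then have "continuous_on UNIV (\<lambda>p. f (A p + c))"
    using 0 S by (auto intro: continuous_on_compose2)
  then show ?case
    using l by (auto intro: bounded_linear.continuous_on)
next
  case (Suc n)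
  have "Ck_on n UNIV (\<lambda>p. l (frechet_derivative f (at (A p + c)) (A v)))" for v
    using Suc.prems by (intro Suc.IH[where f = "\<lambda>q. frechet_derivative f (at q) (A v)"]) simp
  moreover have "f differentiable at (A p + c)" for p
    using Suc.prems S by simp
  ultimately show ?case
    by (simp add: frechet_derivative_affine[OF l A])
qed

named_theorems smooth_intros

lemma smooth_const[smooth_intros]: "smooth_on UNIV (\<lambda>p. c)"
  by (simp add: smooth_on_def Ck_on_const)

lemma smooth_add[smooth_intros]:
  "smooth_on UNIV f \<Longrightarrow> smooth_on UNIV g \<Longrightarrow> smooth_on UNIV (\<lambda>p. f p + g p)"
  by (simp add: smooth_on_def Ck_on_add)

lemma smooth_mult[smooth_intros]:
  fixes f g :: "'a::euclidean_space \<Rightarrow> real"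
  shows "smooth_on UNIV f \<Longrightarrow> smooth_on UNIV g \<Longrightarrow> smooth_on UNIV (\<lambda>p. f p * g p)"
  by (simp add: smooth_on_def Ck_on_mult)

lemma smooth_inverse:
  fixes f :: "'a::euclidean_space \<Rightarrow> real"
  shows "smooth_on UNIV f \<Longrightarrow> (\<And>p. f p \<noteq> 0) \<Longrightarrow> smooth_on UNIV (\<lambda>p. inverse (f p))"
  by (simp add: smooth_on_def Ck_on_inverse)

lemma smooth_minus[smooth_intros]:
  fixes f :: "'a::euclidean_space \<Rightarrow> real"
  shows "smooth_on UNIV f \<Longrightarrow> smooth_on UNIV (\<lambda>p. - f p)"
  by (simp add: smooth_on_def Ck_on_minus)

lemma smooth_diff[smooth_intros]:
  fixes f g :: "'a::euclidean_space \<Rightarrow> real"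
  shows "smooth_on UNIV f \<Longrightarrow> smooth_on UNIV g \<Longrightarrow> smooth_on UNIV (\<lambda>p. f p - g p)"
  using smooth_add[OF _ smooth_minus, of f g] by simp

lemma smooth_sum[smooth_intros]:
  fixes f :: "'i \<Rightarrow> 'a::euclidean_space \<Rightarrow> real"
  assumes "\<And>i. i \<in> I \<Longrightarrow> smooth_on UNIV (f i)"
  shows "smooth_on UNIV (\<lambda>p. \<Sum>i\<in>I. f i p)"
  using assms by (induction I rule: infinite_finite_induct) (auto intro: smooth_intros)

lemma smooth_affine:
  fixes f :: "'a::euclidean_space \<Rightarrow> 'b::real_normed_vector"
  assumes "bounded_linear l" "bounded_linear A" "\<And>p. A p + c \<in> S" "smooth_on S f"
  shows "smooth_on UNIV (\<lambda>p. l (f (A p + c)))"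
  using assms Ck_on_affine[OF assms(1-3)] by (simp add: smooth_on_def)

lemma smooth_imp_differentiable: "smooth_on UNIV f \<Longrightarrow> f differentiable at p"
  unfolding smooth_on_def by (metis Ck_on.simps(2) UNIV_I)

lemma smooth_imp_continuous: "smooth_on UNIV f \<Longrightarrow> continuous_on S f"
  unfolding smooth_on_def by (metis Ck_on.simps(1) continuous_on_subset subset_UNIV)

lemma smooth_frechet_derivative:
  "smooth_on UNIV f \<Longrightarrow> smooth_on UNIV (\<lambda>p. frechet_derivative f (at p) v)"
  unfolding smooth_on_def by (metis Ck_on.simps(2))

lemma has_real_derivative_along_line:
  fixes f :: "'a::euclidean_space \<Rightarrow> real"
  assumes "\<And>q. f differentiable at q"
  shows "((\<lambda>s. f (p + s *\<^sub>R u)) has_real_derivative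
           frechet_derivative f (at (p + s *\<^sub>R u)) u) (at s within S)"
proof -
  let ?D = "frechet_derivative f (at (p + s *\<^sub>R u))"
  have "((\<lambda>s. p + s *\<^sub>R u) has_derivative (\<lambda>t. t *\<^sub>R u)) (at s within S)"
    by (auto intro!: derivative_eq_intros)
  from has_derivative_compose[OF this assms[unfolded frechet_derivative_works]]
  have "((\<lambda>s. f (p + s *\<^sub>R u)) has_derivative (\<lambda>t. ?D (t *\<^sub>R u))) (at s within S)" .
  moreover have "(\<lambda>t. ?D (t *\<^sub>R u)) = (*) (?D u)"
    using linear_frechet_derivative[OF assms] by (simp add: linear_scale fun_eq_iff)
  ultimately show ?thesis
    by (simp add: has_field_derivative_def)
qed

text \<open>The mean value theorem is applied along \<open>u\<close> to the increment of \<open>f\<close> in direction \<open>v\<close>,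
  and then along \<open>v\<close> to the derivative in direction \<open>u\<close>.  The left-hand side is symmetric in \<open>u\<close> and \<open>v\<close>, the right-hand side a priori not.\<close>

lemma second_difference_mean_value:
  fixes f :: "'a::euclidean_space \<Rightarrow> real"
  assumes f: "smooth_on UNIV f" and h: "h > 0"
  obtains a b where "0 < a" "a < h" "0 < b" "b < h"
    "f (p + h *\<^sub>R u + h *\<^sub>R v) - f (p + h *\<^sub>R u) - f (p + h *\<^sub>R v) + f p
      = h * h * frechet_derivative (\<lambda>q. frechet_derivative f (at q) u)
                  (at (p + a *\<^sub>R u + b *\<^sub>R v)) v"
proof -
  let ?f = "\<lambda>q. frechet_derivative f (at q) u"
  note d = has_real_derivative_along_line[OF smooth_imp_differentiable]
  let ?A = "\<lambda>s. f (p + h *\<^sub>R v + s *\<^sub>R u) - f (p + s *\<^sub>R u)"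
  have "(?A has_real_derivative ?f (p + h *\<^sub>R v + s *\<^sub>R u) - ?f (p + s *\<^sub>R u)) (at s)" for s
    by (intro DERIV_diff d f)
  from MVT2[OF h this] obtain a where a: "0 < a" "a < h"
    "?A h - ?A 0 = h * (?f (p + h *\<^sub>R v + a *\<^sub>R u) - ?f (p + a *\<^sub>R u))" by auto
  have "((\<lambda>s. ?f (p + a *\<^sub>R u + s *\<^sub>R v)) has_real_derivative
      frechet_derivative ?f (at (p + a *\<^sub>R u + s *\<^sub>R v)) v) (at s)" for s
    by (intro d smooth_frechet_derivative f)
  from MVT2[OF h this] obtain b where b: "0 < b" "b < h"
    "?f (p + a *\<^sub>R u + h *\<^sub>R v) - ?f (p + a *\<^sub>R u)
      = h * frechet_derivative ?f (at (p + a *\<^sub>R u + b *\<^sub>R v)) v" by auto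
  show ?thesis
    by (rule that[OF a(1,2) b(1,2)]) (use a(3) b(3) in \<open>simp add: algebra_simps\<close>)
qed

text \<open>By the symmetry of the second difference, the two mixed derivatives take a common value at
  points arbitrarily close to \<open>p\<close>; by continuity they agree at \<open>p\<close>.\<close>

lemma symmetric_second_derivative:
  fixes f :: "'a::euclidean_space \<Rightarrow> real"
  assumes f: "smooth_on UNIV f"
  shows "frechet_derivative (\<lambda>q. frechet_derivative f (at q) u) (at p) v
       = frechet_derivative (\<lambda>q. frechet_derivative f (at q) v) (at p) u" (is "?F p = ?G p")
proof -
  have *: "\<exists>q r. dist q p \<le> h * (norm u + norm v) \<and> dist r p \<le> h * (norm u + norm v) \<and> ?F q = ?G r"
    if h: "h > 0" for h
  proof -
    obtain a b where ab: "0 < a" "a < h" "0 < b" "b < h"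
      "f (p + h *\<^sub>R u + h *\<^sub>R v) - f (p + h *\<^sub>R u) - f (p + h *\<^sub>R v) + f p
       = h * h * ?F (p + a *\<^sub>R u + b *\<^sub>R v)"
      by (rule second_difference_mean_value[OF f h])
    obtain c d where cd: "0 < c" "c < h" "0 < d" "d < h"
      "f (p + h *\<^sub>R v + h *\<^sub>R u) - f (p + h *\<^sub>R v) - f (p + h *\<^sub>R u) + f p
       = h * h * ?G (p + c *\<^sub>R v + d *\<^sub>R u)"
      by (rule second_difference_mean_value[OF f h])
    have "h * h * ?F (p + a *\<^sub>R u + b *\<^sub>R v) = h * h * ?G (p + c *\<^sub>R v + d *\<^sub>R u)"
      using ab(5) cd(5) by (simp add: algebra_simps)
    then have "?F (p + a *\<^sub>R u + b *\<^sub>R v) = ?G (p + c *\<^sub>R v + d *\<^sub>R u)"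
      using h by simp
    moreover have "dist (p + s *\<^sub>R u + t *\<^sub>R v) p \<le> h * (norm u + norm v)"
      if "0 < s" "s < h" "0 < t" "t < h" for s t
    proof -
      have "dist (p + s *\<^sub>R u + t *\<^sub>R v) p = norm (s *\<^sub>R u + t *\<^sub>R v)"
        by (simp add: dist_norm algebra_simps)
      also have "\<dots> \<le> s * norm u + t * norm v"
        using norm_triangle_ineq[of "s *\<^sub>R u" "t *\<^sub>R v"] that by simp
      also have "\<dots> \<le> h * norm u + h * norm v"
        using that by (intro add_mono mult_right_mono) auto
      finally show ?thesis by (simp add: algebra_simps)
    qed
    moreover have eq: "p + c *\<^sub>R v + d *\<^sub>R u = p + d *\<^sub>R u + c *\<^sub>R v"
      by (simp add: algebra_simps)
    ultimately show ?thesis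
      using ab(1-4) cd(1-4)
      by (intro exI[of _ "p + a *\<^sub>R u + b *\<^sub>R v"] exI[of _ "p + d *\<^sub>R u + c *\<^sub>R v"])
        (simp only: eq simp_thms)
  qed
  have "\<exists>q r. dist q p \<le> inverse (real (Suc n)) * (norm u + norm v) \<and>
      dist r p \<le> inverse (real (Suc n)) * (norm u + norm v) \<and> ?F q = ?G r" for n
    by (rule *) simp
  then obtain q r where qr: "\<And>n. dist (q n) p \<le> inverse (real (Suc n)) * (norm u + norm v)"
      "\<And>n. dist (r n) p \<le> inverse (real (Suc n)) * (norm u + norm v)" "\<And>n. ?F (q n) = ?G (r n)"
    by metis
  have lim: "(\<lambda>n. inverse (real (Suc n)) * (norm u + norm v)) \<longlonglongrightarrow> 0"
    using tendsto_mult_left_zero[OF LIMSEQ_inverse_real_of_nat] by simp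
  have qp: "q \<longlonglongrightarrow> p"
    by (rule metric_tendsto_imp_tendsto[OF lim])
      (use qr(1) in \<open>auto simp del: of_nat_Suc intro!: always_eventually\<close>)
  have rp: "r \<longlonglongrightarrow> p"
    by (rule metric_tendsto_imp_tendsto[OF lim])
      (use qr(2) in \<open>auto simp del: of_nat_Suc intro!: always_eventually\<close>)
  have "isCont ?F p" "isCont ?G p"
    using smooth_imp_continuous[OF smooth_frechet_derivative[OF smooth_frechet_derivative[OF f]], of UNIV]
    by (simp_all add: continuous_on_eq_continuous_at)
  then have "(\<lambda>n. ?F (q n)) \<longlonglongrightarrow> ?F p" "(\<lambda>n. ?G (r n)) \<longlonglongrightarrow> ?G p"
    using qp rp isCont_tendsto_compose[where g = ?F] isCont_tendsto_compose[where g = ?G] by blast+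
  then show ?thesis using qr(3) by (simp add: LIMSEQ_unique)
qed

section \<open>Integration over a period box\<close>

lemma UNIV_3_distinct:
  fixes i j k :: 3
  assumes "distinct [i, j, k]"
  shows "UNIV = {i, j, k}"
proof -
  have "card {i, j, k} = 3" using assms by simp
  then show ?thesis
    by (intro card_subset_eq[symmetric]) auto
qed

text \<open>Fubini's theorem in three coordinates, with a coordinate of choice innermost, so that the
  fundamental theorem of calculus applies to the derivative in any direction.  Reordering the
  coordinates maps boxes to boxes and preserves their volume.\<close>

lemma integral_box_iterated:
  fixes F :: "real ^ 3 \<Rightarrow> real"
  assumes F: "continuous_on UNIV F" and d: "distinct [i, j, k]"
  shows "integral (cbox 0 c) F = integral (cbox (0, 0) (c $ i, c $ j))
     (\<lambda>x. integral {0..c $ k} (\<lambda>t. F (fst x *\<^sub>R axis i 1 + snd x *\<^sub>R axis j 1 + t *\<^sub>R axis k 1)))"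
proof -
  note U = UNIV_3_distinct[OF d]
  have all: "(\<forall>l. P l) \<longleftrightarrow> P i \<and> P j \<and> P k" for P
    using U by (metis UNIV_I insert_iff singletonD)
  define g :: "(real \<times> real) \<times> real \<Rightarrow> real ^ 3"
    where "g = (\<lambda>((r, s), t). r *\<^sub>R axis i 1 + s *\<^sub>R axis j 1 + t *\<^sub>R axis k 1)"
  define h :: "real ^ 3 \<Rightarrow> (real \<times> real) \<times> real" where "h = (\<lambda>p. ((p $ i, p $ j), p $ k))"
  have gn: "g ((r, s), t) $ i = r" "g ((r, s), t) $ j = s" "g ((r, s), t) $ k = t" for r s t
    using d by (auto simp: g_def axis_def)
  have hg: "h (g x) = x" for x
    by (cases x) (auto simp: h_def gn)
  have gh: "g (h p) = p" for p
    by (auto simp: h_def vec_eq_iff all gn)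
  have mem: "g x \<in> cbox (g u) (g v) \<longleftrightarrow> x \<in> cbox u v" for x u v
    by (cases x; cases u; cases v) (auto simp: mem_box_cart all gn cbox_Pair_eq)
  have gi: "g ` cbox u v = cbox (g u) (g v)" for u v
  proof (intro subset_antisym subsetI)
    fix p assume "p \<in> cbox (g u) (g v)"
    then have "h p \<in> cbox u v" using mem[of "h p" u v] by (simp add: gh)
    then show "p \<in> g ` cbox u v" by (metis gh imageI)
  qed (auto simp: mem)
  have hi: "h ` cbox u v = cbox (h u) (h v)" for u v
  proof -
    have "h ` cbox u v = h ` g ` cbox (h u) (h v)"
      using gi[of "h u" "h v"] by (simp add: gh)
    then show ?thesis by (simp add: image_image hg)
  qed
  have cont: "measure lborel (g ` cbox u v) = 1 * measure lborel (cbox u v)" for u v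
  proof (cases "cbox u v = {}")
    case False
    obtain u1 u2 u3 v1 v2 v3 where uv: "u = ((u1, u2), u3)" "v = ((v1, v2), v3)"
      by (metis prod.exhaust)
    have ne: "cbox (g u) (g v) \<noteq> {}" using False gi by (metis image_is_empty)
    have le: "u1 \<le> v1" "u2 \<le> v2" "u3 \<le> v3"
      using False by (auto simp: uv cbox_Pair_eq)
    have "measure lborel (cbox (g u) (g v)) = (\<Prod>l\<in>{i, j, k}. g v $ l - g u $ l)"
      using content_cbox_cart[OF ne] U by simp
    also have "\<dots> = (v1 - u1) * (v2 - u2) * (v3 - u3)"
      using d by (simp add: uv gn)
    also have "\<dots> = measure lborel (cbox u v)"
      using le by (simp add: uv content_Pair)
    finally show ?thesis using gi by simp
  qed simp
  have cg: "continuous_on UNIV g"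
    unfolding g_def by (auto intro!: continuous_intros simp: case_prod_beta)
  have "(F has_integral integral (cbox 0 c) F) (cbox 0 c)"
    by (intro integrable_integral integrable_continuous continuous_on_subset[OF F]) simp
  moreover have "\<exists>w z. g ` cbox u v = cbox w z" "\<exists>w z. h ` cbox u' v' = cbox w z" for u v u' v'
    using gi hi by blast+
  moreover have "isCont g x" for x
    using cg by (simp only: continuous_on_eq_continuous_at open_UNIV) blast
  ultimately have "((\<lambda>x. F (g x)) has_integral (1 / 1) *\<^sub>R integral (cbox 0 c) F) (h ` cbox 0 c)"
    by (intro has_integral_twiddle[where f = F and g = g and h = h and r = 1] hg gh cont) auto
  then have "integral (cbox 0 c) F = integral (cbox (h 0) (h c)) (\<lambda>x. F (g x))"
    by (simp add: hi integral_unique)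
  also have "\<dots> = integral (cbox (0, 0) (c $ i, c $ j))
      (\<lambda>x. integral (cbox 0 (c $ k)) (\<lambda>t. F (g (x, t))))"
    unfolding h_def zero_index
    by (rule integral_prod_continuous)
      (auto intro!: continuous_on_compose2[OF F] continuous_on_subset[OF cg])
  finally show ?thesis by (simp add: g_def case_prod_beta)
qed

definition torus_corner :: "real \<Rightarrow> real ^ 3" where
  "torus_corner \<kappa> = (\<Sum>i\<in>UNIV. period \<kappa> i)"

lemma torus_corner_nth: "torus_corner \<kappa> $ i = (if i = 3 then \<kappa> else 1)"
proof -
  have "torus_corner \<kappa> $ i = (\<Sum>j\<in>UNIV. if j = i then (if i = 3 then \<kappa> else 1) else 0)"
    unfolding torus_corner_def period_def sum_component by (intro sum.cong) (auto simp: axis_def)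
  then show ?thesis by simp
qed

lemma period_eq_scaleR: "period \<kappa> i = (torus_corner \<kappa> $ i) *\<^sub>R axis i 1"
  by (auto simp: torus_corner_nth period_def vec_eq_iff axis_def)

lemma obtain_distinct:
  fixes k :: 3
  obtains i j where "distinct [i, j, k]"
proof -
  have "k = 1 \<or> k = 2 \<or> k = 3" by (rule exhaust_3)
  then show ?thesis using that[of 2 3] that[of 1 3] that[of 1 2] by force
qed

definition partial :: "3 \<Rightarrow> (real ^ 3 \<Rightarrow> real) \<Rightarrow> real ^ 3 \<Rightarrow> real" where
  "partial i f p = frechet_derivative f (at p) (axis i 1)"

lemma smooth_partial[smooth_intros]: "smooth_on UNIV f \<Longrightarrow> smooth_on UNIV (partial i f)"
  unfolding partial_def[abs_def] by (rule smooth_frechet_derivative)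

text \<open>The innermost integral, taken in direction \<open>k\<close>, is the difference of \<open>f\<close> across one period.\<close>

lemma integral_partial_periodic:
  assumes f: "smooth_on UNIV f" and "\<kappa> > 0" and per: "\<And>p. f (p + period \<kappa> k) = f p"
  shows "integral (cbox 0 (torus_corner \<kappa>)) (partial k f) = 0"
proof -
  obtain i j where d: "distinct [i, j, k]" by (rule obtain_distinct)
  let ?c = "torus_corner \<kappa>"
  have "integral {0..?c $ k} (\<lambda>t. partial k f (q + t *\<^sub>R axis k 1)) = 0" for q
  proof -
    have "((\<lambda>t. partial k f (q + t *\<^sub>R axis k 1)) has_integral
        f (q + (?c $ k) *\<^sub>R axis k 1) - f (q + 0 *\<^sub>R axis k 1)) {0..?c $ k}"
      using \<open>\<kappa> > 0\<close> unfolding partial_def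
      by (intro fundamental_theorem_of_calculus)
        (auto simp: torus_corner_nth has_real_derivative_iff_has_vector_derivative[symmetric]
          intro!: has_real_derivative_along_line smooth_imp_differentiable f)
    then show ?thesis
      using per[of q] by (simp add: period_eq_scaleR integral_unique)
  qed
  then show ?thesis
    by (subst integral_box_iterated[OF _ d]) (auto intro!: smooth_imp_continuous smooth_intros f)
qed

lemma partial_shift:
  assumes f: "smooth_on UNIV f"
  shows "partial k (\<lambda>p. f (p + c)) p = partial k f (p + c)"
  using frechet_derivative_affine(2)[OF bounded_linear_ident bounded_linear_ident
      smooth_imp_differentiable[OF f]]
  by (simp add: partial_def)

lemma smooth_shift:
  assumes "smooth_on UNIV f"
  shows "smooth_on UNIV (\<lambda>p. f (p + c))"
  using smooth_affine[OF bounded_linear_ident bounded_linear_ident _ assms] by simp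

lemma partial_periodic:
  assumes "smooth_on UNIV f" "\<And>p. f (p + c) = f p"
  shows "partial k f (p + c) = partial k f p"
  using partial_shift[OF assms(1), of k c p] assms(2) by simp

text \<open>The divergence theorem on a closed manifold: the integral of a divergence over the torus is
  zero, so a divergence of constant sign vanishes.  Translating \<open>Y\<close> by \<open>p\<close> brings the arbitrary point \<open>p\<close> to the corner of the box.\<close>

lemma nonneg_periodic_divergence_zero:
  assumes Y: "\<And>i. smooth_on UNIV (Y i)" and \<kappa>: "\<kappa> > 0"
    and per: "\<And>i k p. Y i (p + period \<kappa> k) = Y i p"
    and nonneg: "\<And>p. (\<Sum>i\<in>UNIV. partial i (Y i) p) \<ge> 0"
  shows "(\<Sum>i\<in>UNIV. partial i (Y i) p) = 0"
proof -
  let ?d = "\<lambda>q. \<Sum>i\<in>UNIV. partial i (\<lambda>x. Y i (x + p)) q"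
  let ?c = "torus_corner \<kappa>"
  have s: "smooth_on UNIV (\<lambda>q. Y i (q + p))" for i by (intro smooth_shift Y)
  have "integral (cbox 0 ?c) ?d = (\<Sum>i\<in>UNIV. integral (cbox 0 ?c) (partial i (\<lambda>x. Y i (x + p))))"
    by (intro integral_sum integrable_continuous smooth_imp_continuous smooth_intros s) simp
  also have "\<dots> = 0"
  proof (intro sum.neutral ballI integral_partial_periodic s \<kappa>)
    fix i q show "Y i (q + period \<kappa> i + p) = Y i (q + p)"
      using per[of i "q + p" i] by (simp add: algebra_simps)
  qed
  finally have "integral (cbox 0 ?c) ?d = 0" .
  moreover have "continuous_on (cbox 0 ?c) ?d"
    by (intro smooth_imp_continuous smooth_intros s)
  moreover have "box 0 ?c \<noteq> {}" "0 \<in> cbox 0 ?c"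
    using \<kappa> by (auto simp: interval_ne_empty_cart(2) torus_corner_nth mem_box_cart)
  moreover have "?d q \<ge> 0" for q
    using nonneg[of "q + p"] Y by (simp add: partial_shift)
  ultimately have "?d 0 = 0"
    using integral_cbox_eq_0_iff[of 0 ?c ?d] by blast
  then show ?thesis using Y by (simp add: partial_shift)
qed

lemma integral_box_third_coordinate:
  fixes q :: "real \<Rightarrow> real"
  assumes "continuous_on UNIV q"
  shows "integral (cbox 0 (torus_corner \<kappa>)) (\<lambda>p. q (p $ 3)) = integral {0..\<kappa>} q"
proof -
  have d: "distinct [1, 2, 3 :: 3]" by simp
  have "continuous_on UNIV (\<lambda>p :: real ^ 3. q (p $ 3))"
    by (rule continuous_on_compose2[OF assms]) (auto intro!: continuous_intros)
  from integral_box_iterated[OF this d, of "torus_corner \<kappa>"] show ?thesis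
    by (simp add: torus_corner_nth axis_def content_Pair)
qed

section \<open>Forms on a three-dimensional torus as fields\<close>

text \<open>This unfolds the sum over multi-indices in the Hodge star into iterated sums.\<close>

lemma sum_PiE_lessThan_Suc:
  fixes F :: "(nat \<Rightarrow> 'i::finite) \<Rightarrow> 'a::comm_monoid_add"
  shows "(\<Sum>I\<in>{..<Suc n} \<rightarrow>\<^sub>E UNIV. F I) = (\<Sum>y\<in>UNIV. \<Sum>I\<in>{..<n} \<rightarrow>\<^sub>E UNIV. F (I(n := y)))"
proof -
  have "(\<Sum>I\<in>{..<Suc n} \<rightarrow>\<^sub>E UNIV. F I)
      = (\<Sum>(y, I)\<in>UNIV \<times> ({..<n} \<rightarrow>\<^sub>E UNIV). F (I(n := y)))"
    unfolding lessThan_Suc PiE_insert_eq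
    by (subst sum.reindex[OF inj_combinator]) (auto simp: case_prod_beta o_def)
  then show ?thesis by (simp add: sum.cartesian_product)
qed

text \<open>In dimension 3 a form of positive degree is a field: 1-forms are \<open>\<eta> \<bullet> dp\<close>, 2-forms are
  contractions of the Euclidean volume form with a vector field, 3-forms are multiples of it.  The
  exterior derivative then becomes curl and divergence.\<close>

definition covector_form :: "(real ^ 3 \<Rightarrow> real ^ 3) \<Rightarrow> (real ^ 3, real) form" where
  "covector_form \<eta> p v = \<eta> p \<bullet> v 0"

definition flux_form :: "(real ^ 3 \<Rightarrow> real ^ 3) \<Rightarrow> (real ^ 3, real) form" where
  "flux_form X p v = det (vector [X p, v 0, v 1] :: real ^ 3 ^ 3)"

definition density_form :: "(real ^ 3 \<Rightarrow> real) \<Rightarrow> (real ^ 3, real) form" where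
  "density_form f p v = f p * det (vector [v 0, v 1, v 2] :: real ^ 3 ^ 3)"

definition smooth_field :: "(real ^ 3 \<Rightarrow> real ^ 3) \<Rightarrow> bool" where
  "smooth_field X \<longleftrightarrow> (\<forall>i. smooth_on UNIV (\<lambda>p. X p $ i))"

definition divergence :: "(real ^ 3 \<Rightarrow> real ^ 3) \<Rightarrow> real ^ 3 \<Rightarrow> real" where
  "divergence X p = (\<Sum>i\<in>UNIV. partial i (\<lambda>p. X p $ i) p)"

definition curl :: "(real ^ 3 \<Rightarrow> real ^ 3) \<Rightarrow> real ^ 3 \<Rightarrow> real ^ 3" where
  "curl X p = vector
    [partial 2 (\<lambda>p. X p $ 3) p - partial 3 (\<lambda>p. X p $ 2) p,
     partial 3 (\<lambda>p. X p $ 1) p - partial 1 (\<lambda>p. X p $ 3) p,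
     partial 1 (\<lambda>p. X p $ 2) p - partial 2 (\<lambda>p. X p $ 1) p]"

lemma partial_add:
  assumes "smooth_on UNIV f" "smooth_on UNIV h"
  shows "partial i (\<lambda>p. f p + h p) p = partial i f p + partial i h p"
  using assms by (simp add: partial_def frechet_derivative_plus smooth_imp_differentiable)

lemma partial_mult:
  assumes "smooth_on UNIV f" "smooth_on UNIV h"
  shows "partial i (\<lambda>p. f p * h p) p = f p * partial i h p + partial i f p * h p"
  using assms by (simp add: partial_def frechet_derivative_times smooth_imp_differentiable)

lemma partial_const: "partial i (\<lambda>p. c) p = 0"
  by (simp add: partial_def)

lemma partial_diff:
  assumes "smooth_on UNIV f" "smooth_on UNIV h"
  shows "partial i (\<lambda>p. f p - h p) p = partial i f p - partial i h p"
  using partial_add[OF assms(1) smooth_mult[OF smooth_const[of "-1"] assms(2)]]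
    partial_mult[OF smooth_const[of "-1"] assms(2)] by (simp add: partial_const)

lemma frechet_derivative_eq_partials:
  assumes "smooth_on UNIV f"
  shows "frechet_derivative f (at p) v = (\<Sum>i\<in>UNIV. v $ i * partial i f p)"
proof -
  have "linear (frechet_derivative f (at p))"
    using assms by (intro linear_frechet_derivative smooth_imp_differentiable)
  moreover have "v = (\<Sum>i\<in>UNIV. v $ i *\<^sub>R axis i 1)"
    using basis_expansion[of v] by (simp add: scalar_mult_eq_scaleR)
  ultimately have "frechet_derivative f (at p) v
      = (\<Sum>i\<in>UNIV. frechet_derivative f (at p) (v $ i *\<^sub>R axis i 1))"
    using linear_sum[of "frechet_derivative f (at p)" "\<lambda>i. v $ i *\<^sub>R axis i 1" UNIV] by simp
  then show ?thesis
    using \<open>linear _\<close> by (simp add: partial_def linear_scale)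
qed

lemma partial_commute:
  assumes "smooth_on UNIV f"
  shows "partial i (partial j f) p = partial j (partial i f) p"
  using symmetric_second_derivative[OF assms] unfolding partial_def[abs_def] .

lemma partials_zero_imp_constant:
  assumes "smooth_on UNIV f" "\<And>i p. partial i f p = 0"
  shows "f p = f q"
proof -
  have "(f has_derivative (\<lambda>v. 0)) (at x)" for x
  proof -
    have "frechet_derivative f (at x) = (\<lambda>v. 0)"
      using frechet_derivative_eq_partials[OF assms(1)] assms(2) by (intro ext) simp
    then show ?thesis
      using smooth_imp_differentiable[OF assms(1), of x] frechet_derivative_works by metis
  qed
  then show ?thesis
    using has_derivative_zero_unique[of UNIV f p q] by (auto simp: has_derivative_at_withinI)
qed

lemma frechet_derivative_inner_const:
  assumes "smooth_field X"
  shows "frechet_derivative (\<lambda>y. X y \<bullet> u) (at p) v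
       = (\<Sum>i\<in>UNIV. \<Sum>k\<in>UNIV. v $ i * u $ k * partial i (\<lambda>p. X p $ k) p)"
proof -
  have s: "smooth_on UNIV (\<lambda>p. X p $ k)" for k using assms by (simp add: smooth_field_def)
  show ?thesis
    unfolding inner_vec_def inner_real_def
    by (simp add: frechet_derivative_eq_partials smooth_intros s sum_3 partial_add partial_mult partial_const)
      (simp add: algebra_simps)
qed

lemma ext_d_covector_form:
  assumes "smooth_field \<eta>"
  shows "ext_d 1 (covector_form \<eta>) = flux_form (curl \<eta>)"
proof (intro ext)
  fix p v
  have "ext_d 1 (covector_form \<eta>) p v =
     frechet_derivative (\<lambda>y. \<eta> y \<bullet> v 1) (at p) (v 0) - frechet_derivative (\<lambda>y. \<eta> y \<bullet> v 0) (at p) (v 1)"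
    by (simp add: ext_d_def covector_form_def)
  then show "ext_d 1 (covector_form \<eta>) p v = flux_form (curl \<eta>) p v"
    by (simp only: frechet_derivative_inner_const[OF assms], simp add: flux_form_def det_3 curl_def sum_3)
      (simp add: algebra_simps)
qed

lemma ext_d_flux_form:
  assumes "smooth_field X"
  shows "ext_d 2 (flux_form X) = density_form (divergence X)"
proof (intro ext)
  fix p and v :: "nat \<Rightarrow> real ^ 3"
  have f: "flux_form X y w = X y \<bullet> cross3 (w 0) (w 1)" for y w
    by (simp add: flux_form_def dot_cross_det)
  have "ext_d 2 (flux_form X) p v =
     frechet_derivative (\<lambda>y. X y \<bullet> cross3 (v 1) (v 2)) (at p) (v 0)
     - frechet_derivative (\<lambda>y. X y \<bullet> cross3 (v 0) (v 2)) (at p) (v 1)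
     + frechet_derivative (\<lambda>y. X y \<bullet> cross3 (v 0) (v 1)) (at p) (v 2)"
    by (simp add: ext_d_def f numeral_2_eq_2)
  then show "ext_d 2 (flux_form X) p v = density_form (divergence X) p v"
    by (simp only: frechet_derivative_inner_const[OF assms], simp add: density_form_def divergence_def det_3 sum_3 cross3_def)
      (simp add: algebra_simps)
qed

text \<open>Cramer's rule: at determinant 1 a matrix is the adjugate of its inverse.\<close>

lemma inverse_entries:
  fixes A B :: "real ^ 3 ^ 3"
  assumes AB: "A ** B = mat 1" and A: "det A = 1"
  shows "A = vector
    [vector [B$2$2 * B$3$3 - B$2$3 * B$3$2, B$1$3 * B$3$2 - B$1$2 * B$3$3, B$1$2 * B$2$3 - B$1$3 * B$2$2],
     vector [B$2$3 * B$3$1 - B$2$1 * B$3$3, B$1$1 * B$3$3 - B$1$3 * B$3$1, B$1$3 * B$2$1 - B$1$1 * B$2$3],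
     vector [B$2$1 * B$3$2 - B$2$2 * B$3$1, B$1$2 * B$3$1 - B$1$1 * B$3$2, B$1$1 * B$2$2 - B$1$2 * B$2$1]]"
  (is "A = ?C")
proof -
  have "det B = 1"
    using det_mul[of A B] A AB by simp
  moreover have "B ** ?C = mat (det B)"
    unfolding det_3
    by (simp add: vec_eq_iff forall_3 matrix_matrix_mult_def sum_3 mat_def) (simp add: algebra_simps)
  ultimately have "B ** ?C = mat 1" by simp
  then have "A ** (B ** ?C) = A" by simp
  then show ?thesis unfolding matrix_mul_assoc AB by simp
qed

text \<open>If the Gram determinant is 1, the Riemannian volume form is the Euclidean one.  Under the
  identification above the Hodge star then just raises or lowers an index: the star of a 1-form is
  the flux of the dual vector field, and the star of a flux is the dual covector.\<close>

lemma volume_form_unimodular: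
  assumes "det (gram g p) = 1"
  shows "volume_form g p v = det (vector [v 0, v 1, v 2] :: real ^ 3 ^ 3)"
  by (simp add: volume_form_def assms)

lemma matrix_mul_matrix_inv:
  fixes A :: "'a::field ^ 'n ^ 'n"
  assumes "det A \<noteq> 0"
  shows "A ** matrix_inv A = mat 1" "matrix_inv A ** A = mat 1"
  using assms someI_ex[of "\<lambda>A'. A ** A' = mat 1 \<and> A' ** A = mat 1"]
  by (simp_all add: matrix_inv_def invertible_det_nz[symmetric] invertible_def)

lemma hodge_star_1:
  assumes "det (gram g p) = 1"
  shows "hodge_star 1 g (covector_form \<eta>) p v = flux_form (\<lambda>p. \<eta> p v* matrix_inv (gram g p)) p v"
proof -
  have 1: "1 = Suc 0" by simp
  show ?thesis
    unfolding hodge_star_def volume_form_unimodular[OF assms] 1 sum_PiE_lessThan_Suc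
    by (simp add: covector_form_def flux_form_def sum_3 det_3 vector_matrix_mult_def
      inner_axis) (simp add: algebra_simps)
qed

lemma hodge_star_2:
  assumes "det (gram g p) = 1"
  shows "hodge_star 2 g (flux_form X) p v = covector_form (\<lambda>p. gram g p *v X p) p v"
proof -
  have 2: "2 = Suc (Suc 0)" by simp
  define G where "G = matrix_inv (gram g p)"
  have "gram g p ** G = mat 1" unfolding G_def using assms by (intro matrix_mul_matrix_inv) simp
  note K = inverse_entries[OF this assms]
  show ?thesis
    unfolding hodge_star_def volume_form_unimodular[OF assms] 2 sum_PiE_lessThan_Suc covector_form_def
      G_def[symmetric]
    unfolding K
    by (simp add: flux_form_def sum_3 det_3 matrix_vector_mult_def inner_vec_def axis_def)
      (simp add: algebra_simps)
qed

lemma hodge_star_3: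
  assumes "det (gram g p) = 1"
  shows "hodge_star 3 g (density_form f) p v = f p"
proof -
  have 3: "3 = Suc (Suc (Suc 0))" by simp
  define G where "G = matrix_inv (gram g p)"
  have "gram g p ** G = mat 1" unfolding G_def using assms by (intro matrix_mul_matrix_inv) simp
  then have "det G = 1" using det_mul[of "gram g p" G] assms by simp
  moreover have "hodge_star 3 g (density_form f) p v = f p * det G"
    unfolding hodge_star_def volume_form_unimodular[OF assms] 3 sum_PiE_lessThan_Suc
      G_def[symmetric]
    by (simp add: density_form_def sum_3 det_3 axis_def eval_nat_numeral)
      (simp add: algebra_simps)
  ultimately show ?thesis by simp
qed

lemma smooth_field_nth: "smooth_field X \<Longrightarrow> smooth_on UNIV (\<lambda>p. X p $ i)"
  by (simp add: smooth_field_def)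

lemma smooth_divergence: "smooth_field X \<Longrightarrow> smooth_on UNIV (divergence X)"
  unfolding divergence_def[abs_def] by (intro smooth_intros smooth_field_nth)

lemma smooth_curl: "smooth_field X \<Longrightarrow> smooth_field (curl X)"
  unfolding smooth_field_def[of "curl X"] forall_3 curl_def vector_3
  by (intro conjI smooth_intros smooth_field_nth)

lemma smooth_field_matrix_mult:
  assumes "\<And>i j. smooth_on UNIV (\<lambda>p. A p $ i $ j)" "smooth_field X"
  shows "smooth_field (\<lambda>p. A p *v X p)" "smooth_field (\<lambda>p. X p v* A p)"
  using assms(2) unfolding smooth_field_def matrix_vector_mult_def vector_matrix_mult_def
  by (auto intro!: smooth_intros assms(1))

section \<open>Harmonic 1-forms of a unimodular metric\<close>

locale unimodular_torus_metric =
  fixes \<kappa> :: real and g :: "(real ^ 3) metric"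
  assumes \<kappa>_pos: "\<kappa> > 0"
    and smooth_gram: "smooth_on UNIV (\<lambda>p. gram g p $ i $ j)"
    and periodic_gram: "gram g (p + period \<kappa> k) = gram g p"
    and transpose_gram: "transpose (gram g p) = gram g p"
    and gram_pos: "v \<noteq> 0 \<Longrightarrow> v \<bullet> (gram g p *v v) > 0"
    and det_gram: "det (gram g p) = 1"
begin

definition cogram :: "real ^ 3 \<Rightarrow> real ^ 3 ^ 3" where
  "cogram p = matrix_inv (gram g p)"

definition raise :: "(real ^ 3 \<Rightarrow> real ^ 3) \<Rightarrow> real ^ 3 \<Rightarrow> real ^ 3" where
  "raise \<eta> p = \<eta> p v* cogram p"

definition lower :: "(real ^ 3 \<Rightarrow> real ^ 3) \<Rightarrow> real ^ 3 \<Rightarrow> real ^ 3" where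
  "lower X p = gram g p *v X p"

lemma gram_cogram: "gram g p ** cogram p = mat 1" "cogram p ** gram g p = mat 1"
  unfolding cogram_def by (intro matrix_mul_matrix_inv; simp add: det_gram)+

lemma det_cogram: "det (cogram p) = 1"
  using det_mul[of "gram g p" "cogram p"] by (simp add: gram_cogram det_gram)

lemma smooth_cogram: "smooth_on UNIV (\<lambda>p. cogram p $ i $ j)"
proof -
  have "\<forall>i j. smooth_on UNIV (\<lambda>p. cogram p $ i $ j)"
    unfolding inverse_entries[OF gram_cogram(2) det_cogram] forall_3 vector_3
    by (intro conjI smooth_intros smooth_gram)
  then show ?thesis by simp
qed

lemma periodic_cogram: "cogram (p + period \<kappa> k) = cogram p"
  by (simp add: cogram_def periodic_gram)

lemma transpose_cogram: "transpose (cogram p) = cogram p"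
proof -
  have "transpose (cogram p) ** gram g p = mat 1"
    using arg_cong[OF gram_cogram(1)[of p], of transpose]
    by (simp add: matrix_transpose_mul transpose_gram transpose_mat)
  then have "(transpose (cogram p) ** gram g p) ** cogram p = cogram p" by simp
  then show ?thesis by (simp add: matrix_mul_assoc[symmetric] gram_cogram)
qed

lemma smooth_raise: "smooth_field \<eta> \<Longrightarrow> smooth_field (raise \<eta>)"
  unfolding raise_def[abs_def] by (intro smooth_field_matrix_mult smooth_cogram)

lemma smooth_lower: "smooth_field X \<Longrightarrow> smooth_field (lower X)"
  unfolding lower_def[abs_def] by (intro smooth_field_matrix_mult smooth_gram)

lemma raise_eq: "raise \<eta> p = cogram p *v \<eta> p"
  unfolding raise_def using vector_transpose_matrix[of "\<eta> p" "cogram p"] by (simp add: transpose_cogram)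

lemma lower_inner_raise: "lower X p \<bullet> raise \<eta> p = X p \<bullet> \<eta> p"
proof -
  have "gram g p *v X p = X p v* gram g p"
    using vector_transpose_matrix[of "X p" "gram g p"] by (simp add: transpose_gram)
  then have "lower X p \<bullet> raise \<eta> p = X p \<bullet> (gram g p *v (cogram p *v \<eta> p))"
    by (simp add: raise_eq lower_def dot_lmul_matrix)
  then show ?thesis by (simp add: matrix_vector_mul_assoc gram_cogram)
qed

lemma cogram_pos:
  assumes "v \<noteq> 0"
  shows "v \<bullet> (cogram p *v v) > 0"
proof -
  let ?w = "cogram p *v v"
  have v: "v = gram g p *v ?w" by (simp add: matrix_vector_mul_assoc gram_cogram)
  with assms have "?w \<noteq> 0" by (metis matrix_vector_mult_0_right)
  from gram_pos[OF this, of p] show ?thesis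
    unfolding v[symmetric] by (simp add: inner_commute)
qed

lemma hodge_star_covector_form: "hodge_star 1 g (covector_form \<eta>) = flux_form (raise \<eta>)"
  by (intro ext) (simp only: hodge_star_1 det_gram raise_def[abs_def] cogram_def)

lemma hodge_laplacian_covector_form:
  assumes \<eta>: "smooth_field \<eta>"
  shows "hodge_laplacian 1 g (covector_form \<eta>) p v =
    lower (curl (lower (curl \<eta>))) p \<bullet> v 0 - (\<Sum>i\<in>UNIV. v 0 $ i * partial i (divergence (raise \<eta>)) p)"
proof -
  have star2: "hodge_star 2 g (flux_form X) = covector_form (lower X)" for X
    by (intro ext) (simp only: hodge_star_2 det_gram lower_def[abs_def])
  have "codiff 1 g (covector_form \<eta>) = (\<lambda>p v. 0 - divergence (raise \<eta>) p)"
    by (intro ext) (simp add: codiff_def hodge_star_covector_form ext_d_flux_form smooth_raise \<eta> hodge_star_3 det_gram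
       del: One_nat_def)
  then have "ext_d 0 (codiff 1 g (covector_form \<eta>)) p v
      = frechet_derivative (\<lambda>p. 0 - divergence (raise \<eta>) p) (at p) (v 0)"
    by (simp add: ext_d_def)
  also have "\<dots> = - (\<Sum>i\<in>UNIV. v 0 $ i * partial i (divergence (raise \<eta>)) p)"
    by (simp add: frechet_derivative_eq_partials partial_diff partial_const smooth_intros 
      smooth_divergence smooth_raise \<eta> del: diff_0)
      (simp add: sum_negf)
  finally have 1: "ext_d 0 (codiff 1 g (covector_form \<eta>)) p v = \<dots>" .
  have "codiff 2 g (ext_d 1 (covector_form \<eta>)) p v = lower (curl (lower (curl \<eta>))) p \<bullet> v 0"
    by (simp add: codiff_def ext_d_covector_form[unfolded One_nat_def] star2 \<eta> smooth_curl smooth_lower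
      covector_form_def)
  with 1 show ?thesis
    by (simp add: hodge_laplacian_def del: One_nat_def)
qed

end

definition periodic_field :: "real \<Rightarrow> (real ^ 3 \<Rightarrow> real ^ 3) \<Rightarrow> bool" where
  "periodic_field \<kappa> X \<longleftrightarrow> (\<forall>k p. X (p + period \<kappa> k) = X p)"

lemma periodic_curl:
  assumes "smooth_field X" "periodic_field \<kappa> X"
  shows "periodic_field \<kappa> (curl X)"
  using assms by (simp add: periodic_field_def curl_def partial_periodic smooth_field_nth)

lemma periodic_divergence:
  assumes "smooth_field X" "periodic_field \<kappa> X"
  shows "divergence X (p + period \<kappa> k) = divergence X p"
  using assms by (simp add: periodic_field_def divergence_def partial_periodic smooth_field_nth)

context unimodular_torus_metric
begin

lemma periodic_raise: "periodic_field \<kappa> \<eta> \<Longrightarrow> periodic_field \<kappa> (raise \<eta>)"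
  by (simp add: periodic_field_def raise_def periodic_cogram)

lemma periodic_lower: "periodic_field \<kappa> X \<Longrightarrow> periodic_field \<kappa> (lower X)"
  by (simp add: periodic_field_def lower_def periodic_gram)

lemma lower_inner_nonneg: "X p \<bullet> lower X p \<ge> 0"
  and lower_inner_eq_0: "X p \<bullet> lower X p = 0 \<Longrightarrow> X p = 0"
  using gram_pos[of "X p" p] unfolding lower_def by (cases "X p = 0"; force)+

text \<open>With \<open>X\<close> the vector field dual to \<open>\<eta>\<close>, \<open>f = div X\<close> and \<open>H\<close> the covector dual to
  \<open>curl \<eta>\<close>, pairing the Laplacian of \<open>\<eta>\<close> with \<open>\<eta>\<close> gives \<open>\<eta> \<bullet> curl H - X \<bullet> grad f\<close>.  It
  differs from \<open>f\<^sup>2 + |d\<eta>|\<^sup>2\<close> by the divergence of \<open>f X + \<eta> \<times> H\<close>.  So if the Laplacian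
  vanishes, this divergence is nonnegative, and hence zero.\<close>

lemma harmonic_imp_closed_coclosed:
  assumes \<eta>: "smooth_field \<eta>" "periodic_field \<kappa> \<eta>"
    and harmonic: "\<And>p v. hodge_laplacian 1 g (covector_form \<eta>) p v = 0"
  shows "curl \<eta> p = 0" "divergence (raise \<eta>) p = 0"
proof -
  define f where "f = divergence (raise \<eta>)"
  define H where "H = lower (curl \<eta>)"
  define Y where "Y i p = f p * raise \<eta> p $ i + cross3 (\<eta> p) (H p) $ i" for i p
  have sf: "smooth_on UNIV f" unfolding f_def by (intro smooth_divergence smooth_raise \<eta>)
  have sH: "smooth_field H" unfolding H_def by (intro smooth_lower smooth_curl \<eta>)
  note s = sf smooth_field_nth[OF sH] smooth_field_nth[OF \<eta>(1)]
    smooth_field_nth[OF smooth_raise[OF \<eta>(1)]]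
  have "lower (curl H) q \<bullet> v - (\<Sum>i\<in>UNIV. v $ i * partial i f q) = 0" for q v
    using harmonic[of q "\<lambda>_. v"] by (simp add: hodge_laplacian_covector_form \<eta> f_def H_def del: One_nat_def)
  \<comment> \<open>The equation is evaluated on the vector field dual to \<open>\<eta>\<close>.\<close>
  then have "lower (curl H) q \<bullet> raise \<eta> q = (\<Sum>i\<in>UNIV. raise \<eta> q $ i * partial i f q)" for q
    using eq_iff_diff_eq_0 by blast
  then have eq: "(\<Sum>i\<in>UNIV. raise \<eta> q $ i * partial i f q) = curl H q \<bullet> \<eta> q" for q
    unfolding lower_inner_raise by (rule sym)
  have div: "(\<Sum>i\<in>UNIV. partial i (Y i) q) = (f q)\<^sup>2 + curl \<eta> q \<bullet> lower (curl \<eta>) q" for q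
  proof -
    have "(\<Sum>i\<in>UNIV. partial i (Y i) q) =
      f q * divergence (raise \<eta>) q + (\<Sum>i\<in>UNIV. raise \<eta> q $ i * partial i f q)
      + curl \<eta> q \<bullet> H q - curl H q \<bullet> \<eta> q"
      unfolding Y_def[abs_def]
      by (simp add: sum_3 cross3_def partial_add partial_diff partial_mult smooth_intros s
          divergence_def curl_def inner_vec_def) (simp add: algebra_simps)
    then show ?thesis unfolding eq by (simp add: f_def H_def power2_eq_square)
  qed
  have per: "Y i (q + period \<kappa> k) = Y i q" for i k q
    using periodic_divergence[OF smooth_raise periodic_raise] periodic_raise
      periodic_lower[OF periodic_curl] \<eta>
    unfolding Y_def f_def H_def by (simp add: periodic_field_def)
  have sY: "smooth_on UNIV (Y i)" for i
  proof -
    have "\<forall>i. smooth_on UNIV (Y i)"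
      unfolding Y_def[abs_def] forall_3 cross3_def vector_3 by (intro conjI smooth_intros s)
    then show ?thesis by blast
  qed
  have "(f p)\<^sup>2 + curl \<eta> p \<bullet> lower (curl \<eta>) p = 0"
    using nonneg_periodic_divergence_zero[where Y = Y and p = p, OF sY \<kappa>_pos per] div lower_inner_nonneg by simp
  then have "f p = 0" "curl \<eta> p \<bullet> lower (curl \<eta>) p = 0"
    using lower_inner_nonneg[of "curl \<eta>" p] by (simp_all add: add_nonneg_eq_0_iff)
  then show "curl \<eta> p = 0" "divergence (raise \<eta>) p = 0"
    using lower_inner_eq_0 by (simp_all add: f_def)
qed

lemma closed_coclosed_imp_harmonic:
  assumes \<eta>: "smooth_field \<eta>"
    and "\<And>p. curl \<eta> p = 0" "\<And>p. divergence (raise \<eta>) p = 0"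
  shows "hodge_laplacian 1 g (covector_form \<eta>) p v = 0"
proof -
  have "lower (curl \<eta>) = (\<lambda>p. 0)" "divergence (raise \<eta>) = (\<lambda>p. 0)"
    using assms by (auto simp: lower_def)
  moreover have "curl (\<lambda>p. 0) p = 0"
    by (simp add: curl_def partial_const vec_eq_iff forall_3)
  ultimately show ?thesis
    by (simp add: hodge_laplacian_covector_form[OF \<eta>] partial_const lower_def del: One_nat_def)
qed

lemma curl_zero_partial_commute:
  assumes "curl \<eta> p = 0"
  shows "partial i (\<lambda>p. \<eta> p $ j) p = partial j (\<lambda>p. \<eta> p $ i) p"
proof -
  have "\<forall>i j. partial i (\<lambda>p. \<eta> p $ j) p = partial j (\<lambda>p. \<eta> p $ i) p"
    using assms by (auto simp: forall_3 curl_def vec_eq_iff)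
  then show ?thesis by blast
qed

text \<open>Suppose that the metric is invariant in direction \<open>j\<close>.  By closedness the gradient of
  \<open>\<psi> = \<eta>\<^sub>j\<close> is \<open>\<partial>\<^sub>j \<eta>\<close>; by invariance of the metric the vector field dual to it is \<open>\<partial>\<^sub>j X\<close>, where \<open>X\<close>
  is dual to \<open>\<eta>\<close>, and \<open>div (\<partial>\<^sub>j X) = \<partial>\<^sub>j (div X) = 0\<close>.  Therefore \<open>div (\<psi> \<partial>\<^sub>j X) = |grad \<psi>|\<^sup>2\<close> is
  nonnegative, and hence zero.  In contrast to an argument through primitives of closed forms,
  \<open>\<psi>\<close> is a globally defined function whatever the periods of \<open>\<eta>\<close> are.\<close>

lemma killing_component_constant:
  assumes \<eta>: "smooth_field \<eta>" "periodic_field \<kappa> \<eta>"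
    and closed: "\<And>p. curl \<eta> p = 0" and coclosed: "\<And>p. divergence (raise \<eta>) p = 0"
    and inv: "\<And>p i k. partial j (\<lambda>p. cogram p $ i $ k) p = 0"
  shows "\<eta> p $ j = \<eta> q $ j"
proof -
  define X where "X = raise \<eta>"
  \<comment> \<open>\<open>Y = \<psi> \<partial>\<^sub>j X\<close> with \<open>\<psi> = \<eta>\<^sub>j\<close>, and \<open>d = grad \<psi>\<close>\<close>
  define Y where "Y i p = \<eta> p $ j * partial j (\<lambda>p. X p $ i) p" for i p
  define d :: "real ^ 3 \<Rightarrow> real ^ 3" where "d p = (\<chi> k. partial k (\<lambda>p. \<eta> p $ j) p)" for p
  have sX: "smooth_field X" unfolding X_def by (intro smooth_raise \<eta>)
  note s = smooth_field_nth[OF sX] smooth_field_nth[OF \<eta>(1)]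
  have X: "X p $ i = (\<Sum>k\<in>UNIV. cogram p $ k $ i * \<eta> p $ k)" for p i
    by (simp add: X_def raise_def vector_matrix_mult_def mult.commute)
  have dX: "partial j (\<lambda>p. X p $ i) p = (\<Sum>k\<in>UNIV. cogram p $ k $ i * d p $ k)" for i p
    unfolding X
    by (simp add: sum_3 partial_add partial_mult smooth_intros s smooth_cogram inv d_def
       curl_zero_partial_commute[OF closed, where i = j])
  have div: "(\<Sum>i\<in>UNIV. partial i (Y i) q) = d q \<bullet> (cogram q *v d q)" for q
  proof -
    have "(\<Sum>i\<in>UNIV. partial i (Y i) q) =
        (\<Sum>i\<in>UNIV. \<eta> q $ j * partial i (partial j (\<lambda>p. X p $ i)) q + d q $ i * partial j (\<lambda>p. X p $ i) q)"
      unfolding Y_def[abs_def] by (simp add: partial_mult smooth_intros s d_def)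
    also have "\<dots> = \<eta> q $ j * (\<Sum>i\<in>UNIV. partial j (partial i (\<lambda>p. X p $ i)) q)
        + (\<Sum>i\<in>UNIV. d q $ i * partial j (\<lambda>p. X p $ i) q)"
      by (simp add: partial_commute[of _ _ j] s sum.distrib sum_distrib_left)
    also have "(\<Sum>i\<in>UNIV. partial j (partial i (\<lambda>p. X p $ i)) q) = partial j (divergence X) q"
      unfolding divergence_def[abs_def] by (simp add: sum_3 partial_add smooth_intros s)
    also have "divergence X = (\<lambda>p. 0)"
      using coclosed by (auto simp: X_def)
    also have "(\<Sum>i\<in>UNIV. d q $ i * partial j (\<lambda>p. X p $ i) q) = d q \<bullet> (cogram q *v d q)"
      unfolding dX by (simp add: sum_3 inner_vec_def matrix_vector_mult_def) (simp add: algebra_simps)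
    finally show ?thesis by (simp add: partial_const)
  qed
  have "periodic_field \<kappa> X" unfolding X_def by (intro periodic_raise \<eta>)
  then have per: "Y i (q + period \<kappa> k) = Y i q" for i k q
    using \<eta>(2) unfolding Y_def by (simp add: periodic_field_def partial_periodic s)
  have sY: "smooth_on UNIV (Y i)" for i
    unfolding Y_def[abs_def] by (intro smooth_intros s)
  have nonneg: "d q \<bullet> (cogram q *v d q) \<ge> 0" for q
    using cogram_pos[of "d q" q] by (cases "d q = 0") auto
  have "d q \<bullet> (cogram q *v d q) = 0" for q
    using nonneg_periodic_divergence_zero[where Y = Y and p = q, OF sY \<kappa>_pos per] by (simp add: div nonneg)
  then have "d q = 0" for q
    using cogram_pos[of "d q" q] by force
  then have "partial k (\<lambda>p. \<eta> p $ j) q = 0" for k q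
    by (metis d_def vec_lambda_beta zero_index)
  then show ?thesis
    by (intro partials_zero_imp_constant[where f = "\<lambda>p. \<eta> p $ j"] s)
qed

text \<open>For a metric that depends on the third coordinate only, two components of \<open>\<eta>\<close> are
  constant by the previous lemma.  Closedness then makes \<open>\<eta>\<close>, and with it the dual field \<open>X\<close>,
  independent of the first two coordinates, so that \<open>div X = 0\<close> reduces to \<open>\<partial>\<^sub>3 X\<^sub>3 = 0\<close>.\<close>

lemma harmonic_field_invariant:
  assumes \<eta>: "smooth_field \<eta>" "periodic_field \<kappa> \<eta>"
    and inv: "\<And>p i k. partial 1 (\<lambda>p. cogram p $ i $ k) p = 0"
      "\<And>p i k. partial 2 (\<lambda>p. cogram p $ i $ k) p = 0"
    and harmonic: "\<And>p v. hodge_laplacian 1 g (covector_form \<eta>) p v = 0"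
  shows "\<eta> p $ 1 = \<eta> q $ 1" "\<eta> p $ 2 = \<eta> q $ 2" "raise \<eta> p $ 3 = raise \<eta> q $ 3"
proof -
  note closed = harmonic_imp_closed_coclosed(1)[OF \<eta> harmonic]
  note coclosed = harmonic_imp_closed_coclosed(2)[OF \<eta> harmonic]
  show 1: "\<eta> p $ 1 = \<eta> q $ 1" for p q
    by (rule killing_component_constant[OF \<eta> closed coclosed inv(1)])
  show 2: "\<eta> p $ 2 = \<eta> q $ 2" for p q
    by (rule killing_component_constant[OF \<eta> closed coclosed inv(2)])
  note s = smooth_field_nth[OF \<eta>(1)] smooth_field_nth[OF smooth_raise[OF \<eta>(1)]]
  have "(\<lambda>p. \<eta> p $ 1) = (\<lambda>p. \<eta> 0 $ 1)" "(\<lambda>p. \<eta> p $ 2) = (\<lambda>p. \<eta> 0 $ 2)"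
    using 1 2 by blast+
  then have d: "partial i (\<lambda>p. \<eta> p $ 1) x = 0" "partial i (\<lambda>p. \<eta> p $ 2) x = 0" for i x
    by (simp_all add: partial_const)
  have d3: "partial 1 (\<lambda>p. \<eta> p $ 3) x = 0" "partial 2 (\<lambda>p. \<eta> p $ 3) x = 0" for x
    using curl_zero_partial_commute[OF closed, where i = 1 and j = 3]
      curl_zero_partial_commute[OF closed, where i = 2 and j = 3] d
    by auto
  have X: "raise \<eta> p $ i = (\<Sum>k\<in>UNIV. cogram p $ k $ i * \<eta> p $ k)" for p i
    by (simp add: raise_def vector_matrix_mult_def mult.commute)
  have dX: "partial 1 (\<lambda>p. raise \<eta> p $ i) x = 0" "partial 2 (\<lambda>p. raise \<eta> p $ i) x = 0" for i x
    unfolding X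
    by (simp_all add: sum_3 partial_add partial_mult smooth_intros s smooth_cogram inv d d3)
  then have "partial 3 (\<lambda>p. raise \<eta> p $ 3) x = 0" for x
    using coclosed[of x] by (simp add: divergence_def sum_3)
  then have "partial i (\<lambda>p. raise \<eta> p $ 3) x = 0" for i x
    using dX exhaust_3[of i] by auto
  then show "raise \<eta> p $ 3 = raise \<eta> q $ 3"
    by (intro partials_zero_imp_constant[where f = "\<lambda>p. raise \<eta> p $ 3"] s)
qed

end

section \<open>Passing between forms and fields\<close>

lemma torus_form_covector_form:
  assumes "smooth_field \<eta>" "periodic_field \<kappa> \<eta>"
  shows "torus_form \<kappa> 1 (covector_form \<eta>)"
proof -
  have "linear (\<lambda>x. \<eta> p \<bullet> (v(i := x)) 0)" if "i < 1" for p i and v :: "nat \<Rightarrow> real ^ 3"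
    using that by (simp add: bounded_linear.linear bounded_linear_inner_right)
  moreover have "smooth_on UNIV (\<lambda>p. \<eta> p \<bullet> v 0)" for v :: "nat \<Rightarrow> real ^ 3"
    unfolding inner_vec_def inner_real_def by (intro smooth_intros smooth_field_nth assms)
  ultimately show ?thesis
    using assms(2) unfolding torus_form_def differential_form_def alternating_map_def covector_form_def
    by (auto simp: periodic_field_def)
qed

lemma covector_form_inject: "covector_form \<eta> = covector_form \<eta>' \<longleftrightarrow> \<eta> = \<eta>'"
proof
  assume eq: "covector_form \<eta> = covector_form \<eta>'"
  have "\<eta> p = \<eta>' p" for p
  proof (rule vector_eq_ldot[THEN iffD1], rule allI)
    fix z
    show "z \<bullet> \<eta> p = z \<bullet> \<eta>' p"
      using fun_cong[OF fun_cong[OF eq], of p "\<lambda>_. z"] by (simp add: covector_form_def inner_commute)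
  qed
  then show "\<eta> = \<eta>'" by blast
qed simp

lemma torus_1form_eq_covector_form:
  assumes "torus_form \<kappa> 1 \<theta>"
  obtains \<eta> where "smooth_field \<eta>" "periodic_field \<kappa> \<eta>" "\<theta> = covector_form \<eta>"
proof -
  define \<eta> :: "real ^ 3 \<Rightarrow> real ^ 3" where "\<eta> p = (\<chi> i. \<theta> p (\<lambda>_. axis i 1))" for p
  have alt: "alternating_map 1 (\<theta> p)" for p
    using assms by (simp add: torus_form_def differential_form_def)
  have "\<theta> p v = \<eta> p \<bullet> v 0" for p v
  proof -
    have lin: "linear (\<lambda>x. \<theta> p ((\<lambda>_. 0)(0 := x)))"
      by (rule conjunct1[OF conjunct2[OF alt[of p, unfolded alternating_map_def]], rule_format]) simp
    have dep: "\<theta> p ((\<lambda>_. 0)(0 := x)) = \<theta> p w" if "w 0 = x" for x w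
      using that by (intro conjunct1[OF alt[of p, unfolded alternating_map_def], rule_format]) simp
    have "\<theta> p v = \<theta> p ((\<lambda>_. 0)(0 := v 0))" by (rule dep[symmetric]) simp
    also have "v 0 = (\<Sum>i\<in>UNIV. v 0 $ i *\<^sub>R axis i 1)"
      using basis_expansion[of "v 0"] by (simp add: scalar_mult_eq_scaleR)
    also have "\<theta> p ((\<lambda>_. 0)(0 := \<Sum>i\<in>UNIV. v 0 $ i *\<^sub>R axis i 1))
        = (\<Sum>i\<in>UNIV. v 0 $ i * \<theta> p ((\<lambda>_. 0)(0 := axis i 1)))"
      using linear_sum[OF lin, of "\<lambda>i. v 0 $ i *\<^sub>R axis i 1" UNIV] linear_scale[OF lin] by simp
    also have "\<dots> = (\<Sum>i\<in>UNIV. v 0 $ i * \<theta> p (\<lambda>_. axis i 1))"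
      by (intro sum.cong refl arg_cong2[where f = "(*)"] dep)
    finally show ?thesis by (simp add: \<eta>_def inner_vec_def mult.commute)
  qed
  then have "\<theta> = covector_form \<eta>" by (intro ext) (simp add: covector_form_def)
  moreover have "smooth_field \<eta>" "periodic_field \<kappa> \<eta>"
    using assms by (auto simp: smooth_field_def \<eta>_def periodic_field_def torus_form_def differential_form_def)
  ultimately show ?thesis using that by blast
qed

lemma sum_permutes_3:
  "(\<Sum>\<pi> | \<pi> permutes {..<3::nat}. F \<pi>) =
     F id + F (Transposition.transpose 1 2)
     + F (Transposition.transpose 0 1) + F (Transposition.transpose 0 1 \<circ> Transposition.transpose 1 2)
     + F (Transposition.transpose 0 2) + F (Transposition.transpose 0 2 \<circ> Transposition.transpose 1 2)"
proof -
  have 3: "{..<3::nat} = insert 0 (insert 1 {2})" by auto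
  show ?thesis
    unfolding 3
    by (subst sum_over_permutations_insert, simp, simp)
      (subst sum_over_permutations_insert, simp, simp, simp add: permutes_sing add.assoc)
qed

lemma wedge_covector_flux:
  "wedge 1 2 (covector_form \<eta>) (flux_form X) p v =
     (\<eta> p \<bullet> X p) * det (vector [v 0, v 1, v 2] :: real ^ 3 ^ 3)"
proof -
  have *: "{..<1 + 2 :: nat} = {..<3}" by simp
  have sg: "sign (Transposition.transpose 0 1 \<circ> Transposition.transpose 1 (2::nat)) = 1"
    "sign (Transposition.transpose 0 2 \<circ> Transposition.transpose 1 (2::nat)) = 1"
    by (simp_all add: sign_compose sign_swap_id permutation_swap_id)
  show ?thesis
    unfolding wedge_def * sum_permutes_3
    by (simp add: sg sign_swap_id sign_id covector_form_def flux_form_def det_3 inner_vec_def sum_3 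
       Transposition.transpose_def del: One_nat_def)
      (simp add: algebra_simps)
qed

lemma partial_invariant_zero:
  assumes "smooth_on UNIV f" "\<And>p s. f (p + s *\<^sub>R axis j 1) = f p"
  shows "partial j f p = 0"
proof -
  have "((\<lambda>s. f (p + s *\<^sub>R axis j 1)) has_real_derivative partial j f p) (at 0)"
    using has_real_derivative_along_line[OF smooth_imp_differentiable[OF assms(1)], of p "axis j 1" 0 UNIV]
    by (simp add: partial_def)
  then show ?thesis
    unfolding assms(2) using DERIV_unique DERIV_const by blast
qed

lemma smooth_third_coordinate:
  fixes f :: "real \<Rightarrow> real"
  assumes "smooth_on UNIV f"
  shows "smooth_on UNIV (\<lambda>p :: real ^ 3. f (p $ 3))"
  using smooth_affine[OF bounded_linear_ident bounded_linear_vec_nth[of 3] _ assms, where c = 0] by simp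

lemma matrix_inv_2:
  fixes A :: "'a::field ^ 2 ^ 2"
  assumes "det A \<noteq> 0"
  shows "matrix_inv A = vector
    [vector [A $ 2 $ 2 / det A, - A $ 1 $ 2 / det A], vector [- A $ 2 $ 1 / det A, A $ 1 $ 1 / det A]]"
  (is "_ = ?B")
proof -
  define d where "d = det A"
  have d: "d = A $ 1 $ 1 * A $ 2 $ 2 - A $ 1 $ 2 * A $ 2 $ 1" by (simp add: d_def det_2)
  have "A ** ?B = mat 1"
    using assms unfolding d_def[symmetric]
    by (simp add: vec_eq_iff forall_2 matrix_matrix_mult_def sum_2 mat_def divide_simps) (simp add: d algebra_simps)
  then have "(matrix_inv A ** A) ** ?B = matrix_inv A"
    by (simp flip: matrix_mul_assoc)
  then show ?thesis by (simp add: matrix_mul_matrix_inv assms)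
qed

section \<open>Metrics on a principal 2-torus bundle over a circle\<close>

text \<open>The metric is \<open>det W\<^sup>-\<^sup>1 dx\<^sup>2 + \<beta>\<^sup>T W \<beta>\<close>, where \<open>\<beta> = d\<phi> + a dx\<close> is a connection form: \<open>W\<close> is
  the metric on the torus orbits, and the length element of the base circle is chosen so as to
  make the total volume form \<open>d\<phi>\<^sub>1 \<and> d\<phi>\<^sub>2 \<and> dx\<close>.\<close>

locale fibre_metric =
  fixes \<kappa> :: real and g :: "(real ^ 3) metric"
    and W :: "real \<Rightarrow> real ^ 2 ^ 2" and a :: "real \<Rightarrow> real ^ 2"
  assumes pos: "\<kappa> > 0"
    and smooth_W: "smooth_on UNIV (\<lambda>x. W x $ i $ j)"
    and smooth_a: "smooth_on UNIV (\<lambda>x. a x $ i)"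
    and periodic_W: "W (x + \<kappa>) = W x"
    and periodic_a: "a (x + \<kappa>) = a x"
    and transpose_W: "transpose (W x) = W x"
    and W_pos: "e \<noteq> 0 \<Longrightarrow> e \<bullet> (W x *v e) > 0"
    and g_eq: "g p v w = det (matrix_inv (W (p $ 3))) * (v $ 3 * w $ 3) +
      vector [v $ 1 + a (p $ 3) $ 1 * v $ 3, v $ 2 + a (p $ 3) $ 2 * v $ 3] \<bullet>
        (W (p $ 3) *v vector [w $ 1 + a (p $ 3) $ 1 * w $ 3, w $ 2 + a (p $ 3) $ 2 * w $ 3])"
begin

definition V :: "real \<Rightarrow> real ^ 2 ^ 2" where "V x = matrix_inv (W x)"

lemma W_sym: "W x $ 2 $ 1 = W x $ 1 $ 2"
  using arg_cong[OF transpose_W[of x], of "\<lambda>A. A $ 1 $ 2"] by (simp add: transpose_def)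

lemma det_W_pos: "det (W x) > 0"
proof -
  have "0 < W x $ 1 $ 1"
    using W_pos[of "vector [1, 0]" x]
    by (simp add: vec_eq_iff inner_vec_def forall_2 matrix_vector_mult_def sum_2)
  moreover have "0 < W x $ 1 $ 1 * det (W x)"
    \<comment> \<open>the quadratic form takes the value \<open>W\<^sub>1\<^sub>1 det W\<close> on this vector\<close>
    using W_pos[of "vector [- W x $ 1 $ 2, W x $ 1 $ 1]" x] \<open>0 < W x $ 1 $ 1\<close>
    by (simp add: vec_eq_iff inner_vec_def forall_2 matrix_vector_mult_def sum_2 det_2 W_sym algebra_simps)
  ultimately show ?thesis by (simp add: zero_less_mult_iff)
qed

lemma V_entries: "V x $ 1 $ 1 = W x $ 2 $ 2 * inverse (det (W x))"
  "V x $ 1 $ 2 = - W x $ 1 $ 2 * inverse (det (W x))"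
  "V x $ 2 $ 1 = - W x $ 1 $ 2 * inverse (det (W x))"
  "V x $ 2 $ 2 = W x $ 1 $ 1 * inverse (det (W x))"
  using det_W_pos[of x] by (simp_all add: V_def matrix_inv_2 W_sym divide_inverse)

lemma W_V: "W x $ i $ 1 * V x $ 1 $ j + W x $ i $ 2 * V x $ 2 $ j = (if i = j then 1 else 0)"
proof -
  have "(W x ** V x) $ i $ j = mat 1 $ i $ j"
    using det_W_pos[of x] by (simp add: V_def matrix_mul_matrix_inv)
  then show ?thesis by (simp add: matrix_matrix_mult_def sum_2 mat_def)
qed

lemma det_V: "det (V x) * det (W x) = 1"
  using det_W_pos[of x] det_mul[of "W x" "V x"] by (simp add: V_def matrix_mul_matrix_inv mult.commute)

lemma det_V_pos: "det (V x) > 0"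
  using det_V[of x] det_W_pos[of x] by (metis zero_less_mult_pos2 zero_less_one)

lemma smooth_det_W: "smooth_on UNIV (\<lambda>x. det (W x))"
  unfolding det_2 by (intro smooth_intros smooth_W)

lemma smooth_V: "smooth_on UNIV (\<lambda>x. V x $ i $ j)"
proof -
  have "smooth_on UNIV (\<lambda>x. inverse (det (W x)))"
    using det_W_pos by (intro smooth_inverse smooth_det_W) (metis less_irrefl)
  then have "\<forall>i j. smooth_on UNIV (\<lambda>x. V x $ i $ j)"
    unfolding forall_2 V_entries by (intro conjI smooth_intros smooth_W)
  then show ?thesis by blast
qed

lemma smooth_det_V: "smooth_on UNIV (\<lambda>x. det (V x))"
  unfolding det_2 by (intro smooth_intros smooth_V)

lemma gram_eq: "gram g p = (let x = p $ 3; b = W x *v a x in vector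
    [vector [W x $ 1 $ 1, W x $ 1 $ 2, b $ 1],
     vector [W x $ 2 $ 1, W x $ 2 $ 2, b $ 2],
     vector [b $ 1, b $ 2, det (V x) + a x \<bullet> b]])"
  by (simp add: gram_def vec_eq_iff forall_3 g_eq V_def[symmetric] Let_def axis_def inner_vec_def
      matrix_vector_mult_def sum_2 W_sym algebra_simps)

lemma gram_quadratic: "v \<bullet> (gram g p *v w) = g p v w"
  by (simp add: gram_eq g_eq V_def[symmetric] Let_def inner_vec_def matrix_vector_mult_def sum_2 sum_3 W_sym)
    (simp add: algebra_simps)


sublocale unimodular_torus_metric \<kappa> g
proof
  show "\<kappa> > 0" by (rule pos)
  have "\<forall>i j. smooth_on UNIV (\<lambda>p. gram g p $ i $ j)"
    unfolding gram_eq Let_def forall_3 vector_3 matrix_vector_mult_def inner_vec_def inner_real_def vec_lambda_beta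
    by (intro conjI smooth_intros smooth_third_coordinate[OF smooth_W] 
      smooth_third_coordinate[OF smooth_det_V] smooth_third_coordinate[OF smooth_a])
  then show "smooth_on UNIV (\<lambda>p. gram g p $ i $ j)" for i j by blast
  have same: "gram g p = gram g q" if "W (p $ 3) = W (q $ 3)" "a (p $ 3) = a (q $ 3)" for p q
    using that by (simp add: gram_eq V_def Let_def)
  show "gram g (p + period \<kappa> k) = gram g p" for p k
    by (intro same) (simp_all add: period_def axis_def periodic_W periodic_a)
  show "transpose (gram g p) = gram g p" for p
    by (simp add: gram_eq Let_def transpose_def vec_eq_iff forall_3 W_sym)
  show "v \<bullet> (gram g p *v v) > 0" if "v \<noteq> 0" for v p
  proof -
    let ?x = "p $ 3"
    let ?b = "vector [v $ 1 + a ?x $ 1 * v $ 3, v $ 2 + a ?x $ 2 * v $ 3] :: real ^ 2"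
    have eq: "g p v v = det (V ?x) * (v $ 3 * v $ 3) + ?b \<bullet> (W ?x *v ?b)"
      by (simp add: g_eq V_def)
    have nonneg: "?b \<bullet> (W ?x *v ?b) \<ge> 0"
      using W_pos[of ?b ?x] by (cases "?b = 0") auto
    show ?thesis
    proof (cases "v $ 3 = 0")
      case True
      then have "?b \<noteq> 0" using that by (auto simp: vec_eq_iff forall_2 forall_3)
      then show ?thesis using W_pos[of ?b ?x] True by (simp add: gram_quadratic eq)
    next
      case False
      then have "v $ 3 * v $ 3 > 0" by (simp add: zero_less_mult_iff) linarith
      then show ?thesis using det_V_pos[of ?x] nonneg
        by (simp only: gram_quadratic eq) (simp add: add_pos_nonneg)
    qed
  qed
  show "det (gram g p) = 1" for p
  proof -
    have "det (gram g p) = det (V (p $ 3)) * det (W (p $ 3))"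
      unfolding det_3 det_2[of "W _"] gram_eq Let_def vector_3
      by (simp add: inner_vec_def matrix_vector_mult_def sum_2) (simp add: W_sym algebra_simps)
    then show ?thesis by (simp add: det_V)
  qed
qed

text \<open>The parameters are the two constant components and the constant flux in direction \<open>x\<close>; the
  coefficient of \<open>dx\<close> is what this flux forces it to be.\<close>

definition harmonic_field :: "real ^ 3 \<Rightarrow> real ^ 3 \<Rightarrow> real ^ 3" where
  "harmonic_field c p = vector [c $ 1, c $ 2,
     det (V (p $ 3)) * c $ 3 + a (p $ 3) $ 1 * c $ 1 + a (p $ 3) $ 2 * c $ 2]"

lemma raise_eqI:
  assumes "gram g p *v X = \<eta> p"
  shows "raise \<eta> p = X"
  unfolding raise_eq assms[symmetric] by (simp add: matrix_vector_mul_assoc gram_cogram)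

text \<open>In the frame \<open>\<partial>\<phi>\<^sub>1, \<partial>\<phi>\<^sub>2, \<partial>x - a \<bullet> \<partial>\<phi>\<close>, whose last vector is horizontal, the inverse metric is
  the block matrix of \<open>W\<^sup>-\<^sup>1\<close> and \<open>det W\<close>.  So \<open>C\<close> is \<open>det W\<close> times the value of \<open>\<eta>\<close> on the
  horizontal vector.\<close>

lemma raise_explicit:
  fixes \<eta> :: "real ^ 3 \<Rightarrow> real ^ 3" and p :: "real ^ 3"
  defines "x \<equiv> p $ 3"
  defines "C \<equiv> det (W x) * (\<eta> p $ 3 - a x $ 1 * \<eta> p $ 1 - a x $ 2 * \<eta> p $ 2)"
  shows "raise \<eta> p = vector
    [V x $ 1 $ 1 * \<eta> p $ 1 + V x $ 1 $ 2 * \<eta> p $ 2 - a x $ 1 * C,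
     V x $ 2 $ 1 * \<eta> p $ 1 + V x $ 2 $ 2 * \<eta> p $ 2 - a x $ 2 * C, C]"
proof (rule raise_eqI)
  let ?X = "vector [V x $ 1 $ 1 * \<eta> p $ 1 + V x $ 1 $ 2 * \<eta> p $ 2 - a x $ 1 * C,
     V x $ 2 $ 1 * \<eta> p $ 1 + V x $ 2 $ 2 * \<eta> p $ 2 - a x $ 2 * C, C] :: real ^ 3"
  \<comment> \<open>the vertical part \<open>W\<^sup>-\<^sup>1 (\<eta>\<^sub>1, \<eta>\<^sub>2)\<close> of \<open>X\<close>, which \<open>W\<close> maps back to \<open>(\<eta>\<^sub>1, \<eta>\<^sub>2)\<close>\<close>
  define y1 where "y1 = ?X $ 1 + a x $ 1 * C"
  define y2 where "y2 = ?X $ 2 + a x $ 2 * C"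
  have y: "W x $ i $ 1 * y1 + W x $ i $ 2 * y2 =
      (if i = 1 then 1 else 0) * \<eta> p $ 1 + (if i = 2 then 1 else 0) * \<eta> p $ 2" for i
  proof -
    have "W x $ i $ 1 * y1 + W x $ i $ 2 * y2 =
      (W x $ i $ 1 * V x $ 1 $ 1 + W x $ i $ 2 * V x $ 2 $ 1) * \<eta> p $ 1 +
      (W x $ i $ 1 * V x $ 1 $ 2 + W x $ i $ 2 * V x $ 2 $ 2) * \<eta> p $ 2"
      by (simp add: y1_def y2_def algebra_simps)
    then show ?thesis unfolding W_V .
  qed
  have 1: "W x $ 1 $ 1 * y1 + W x $ 1 $ 2 * y2 = \<eta> p $ 1" using y[of 1] by simp
  have 2: "W x $ 2 $ 1 * y1 + W x $ 2 $ 2 * y2 = \<eta> p $ 2" using y[of 2] by simp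
  have "(gram g p *v ?X) $ 1 = W x $ 1 $ 1 * y1 + W x $ 1 $ 2 * y2"
    "(gram g p *v ?X) $ 2 = W x $ 2 $ 1 * y1 + W x $ 2 $ 2 * y2"
    "(gram g p *v ?X) $ 3 = a x $ 1 * (W x $ 1 $ 1 * y1 + W x $ 1 $ 2 * y2)
       + a x $ 2 * (W x $ 2 $ 1 * y1 + W x $ 2 $ 2 * y2) + det (V x) * C"
    unfolding y1_def y2_def
    by (simp_all add: gram_eq x_def[symmetric] Let_def matrix_vector_mult_def inner_vec_def sum_3 sum_2)
      (simp_all add: W_sym algebra_simps)
  moreover have "det (V x) * C = \<eta> p $ 3 - a x $ 1 * \<eta> p $ 1 - a x $ 2 * \<eta> p $ 2"
    using det_V[of x] by (simp add: C_def flip: mult.assoc)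
  ultimately show "gram g p *v ?X = \<eta> p"
    by (simp add: 1 2 vec_eq_iff forall_3)
qed

lemma raise_harmonic_field:
  "raise (harmonic_field c) p = vector
    [V (p $ 3) $ 1 $ 1 * c $ 1 + V (p $ 3) $ 1 $ 2 * c $ 2 - a (p $ 3) $ 1 * c $ 3,
     V (p $ 3) $ 2 $ 1 * c $ 1 + V (p $ 3) $ 2 $ 2 * c $ 2 - a (p $ 3) $ 2 * c $ 3, c $ 3]"
proof -
  have "det (W x) * (det (V x) * z) = z" for x z
    using det_V[of x] by (simp add: mult.commute[of "det (W x)"] flip: mult.assoc)
  then have C: "det (W (p $ 3)) * (harmonic_field c p $ 3 - a (p $ 3) $ 1 * harmonic_field c p $ 1
      - a (p $ 3) $ 2 * harmonic_field c p $ 2) = c $ 3"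
    unfolding harmonic_field_def vector_3 by (simp only: add_diff_cancel_right' diff_diff_eq add.assoc)
  show ?thesis
    unfolding raise_explicit C by (simp add: harmonic_field_def)
qed

lemma smooth_harmonic_field: "smooth_field (harmonic_field c)"
  unfolding smooth_field_def forall_3 harmonic_field_def vector_3
  by (intro conjI smooth_intros smooth_third_coordinate[OF smooth_det_V] smooth_third_coordinate[OF smooth_a])

lemma periodic_harmonic_field: "periodic_field \<kappa> (harmonic_field c)"
  by (simp add: periodic_field_def harmonic_field_def period_def axis_def periodic_W periodic_a V_def)

lemma harmonic_1form_harmonic_field: "harmonic_1form \<kappa> g (covector_form (harmonic_field c))"
proof -
  let ?\<eta> = "harmonic_field c"
  note s = smooth_field_nth[OF smooth_harmonic_field] smooth_field_nth[OF smooth_raise[OF smooth_harmonic_field]]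
  have third: "partial j (\<lambda>p. ?\<eta> p $ i) p = 0" "partial j (\<lambda>p. raise ?\<eta> p $ i) p = 0"
    if "j \<noteq> 3" for i j p
  proof -
    have ax: "(p + s *\<^sub>R axis j 1) $ 3 = p $ 3" for s and p :: "real ^ 3"
      using that by (simp add: axis_def)
    show "partial j (\<lambda>p. ?\<eta> p $ i) p = 0"
      by (rule partial_invariant_zero[OF s(1)]) (simp only: harmonic_field_def ax)
    show "partial j (\<lambda>p. raise ?\<eta> p $ i) p = 0"
      by (rule partial_invariant_zero[OF s(2)]) (simp only: raise_harmonic_field ax)
  qed
  have "curl ?\<eta> p = 0" for p
  proof -
    have "(\<lambda>p. ?\<eta> p $ 1) = (\<lambda>p. c $ 1)" "(\<lambda>p. ?\<eta> p $ 2) = (\<lambda>p. c $ 2)"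
      by (simp_all add: harmonic_field_def)
    then have "partial 3 (\<lambda>p. ?\<eta> p $ 1) p = 0" "partial 3 (\<lambda>p. ?\<eta> p $ 2) p = 0"
      by (simp_all add: partial_const)
    then show ?thesis by (simp add: curl_def third vec_eq_iff forall_3)
  qed
  moreover have "divergence (raise ?\<eta>) p = 0" for p
  proof -
    have "(\<lambda>p. raise ?\<eta> p $ 3) = (\<lambda>p. c $ 3)"
      by (simp add: raise_harmonic_field)
    then have "partial 3 (\<lambda>p. raise ?\<eta> p $ 3) p = 0" by (simp add: partial_const)
    then show ?thesis by (simp add: divergence_def sum_3 third)
  qed
  ultimately show ?thesis
    unfolding harmonic_1form_def
    using closed_coclosed_imp_harmonic[OF smooth_harmonic_field]
      torus_form_covector_form[OF smooth_harmonic_field periodic_harmonic_field] by blast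
qed

lemma harmonic_1form_iff: "harmonic_1form \<kappa> g \<theta> \<longleftrightarrow> (\<exists>c. \<theta> = covector_form (harmonic_field c))"
proof
  assume h: "harmonic_1form \<kappa> g \<theta>"
  then obtain \<eta> where \<eta>: "smooth_field \<eta>" "periodic_field \<kappa> \<eta>" "\<theta> = covector_form \<eta>"
    unfolding harmonic_1form_def using torus_1form_eq_covector_form by metis
  have inv: "partial j (\<lambda>p. cogram p $ i $ k) p = 0" if "j \<noteq> 3" for i j k p
  proof (rule partial_invariant_zero[OF smooth_cogram])
    show "cogram (p + s *\<^sub>R axis j 1) $ i $ k = cogram p $ i $ k" for p s
      using that by (simp add: cogram_def gram_eq axis_def)
  qed
  have lap: "hodge_laplacian 1 g (covector_form \<eta>) p v = 0" for p v
    using h by (simp add: harmonic_1form_def \<eta>(3))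
  define c :: "real ^ 3" where "c = vector [\<eta> 0 $ 1, \<eta> 0 $ 2, raise \<eta> 0 $ 3]"
  have c: "\<eta> p $ 1 = c $ 1" "\<eta> p $ 2 = c $ 2" "raise \<eta> p $ 3 = c $ 3" for p
    using harmonic_field_invariant[OF \<eta>(1,2) inv inv lap, of p 0] by (simp_all add: c_def)
  have "\<eta> p = harmonic_field c p" for p
  proof -
    have "det (W (p $ 3)) * (\<eta> p $ 3 - a (p $ 3) $ 1 * c $ 1 - a (p $ 3) $ 2 * c $ 2) = c $ 3"
      using c[of p] unfolding raise_explicit by simp
    then have "det (V (p $ 3)) * c $ 3 = det (V (p $ 3)) *
        (det (W (p $ 3)) * (\<eta> p $ 3 - a (p $ 3) $ 1 * c $ 1 - a (p $ 3) $ 2 * c $ 2))"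
      by simp
    also have "\<dots> = \<eta> p $ 3 - a (p $ 3) $ 1 * c $ 1 - a (p $ 3) $ 2 * c $ 2"
      by (simp add: det_V flip: mult.assoc)
    finally show ?thesis
      by (simp add: harmonic_field_def vec_eq_iff forall_3 c)
  qed
  then show "\<exists>c. \<theta> = covector_form (harmonic_field c)"
    using \<eta>(3) by (metis ext)
qed (auto simp: harmonic_1form_harmonic_field)

lemma harmonic_field_inject: "harmonic_field c = harmonic_field c' \<longleftrightarrow> c = c'"
proof
  assume eq: "harmonic_field c = harmonic_field c'"
  have "raise (harmonic_field c) 0 $ 3 = raise (harmonic_field c') 0 $ 3"
    "harmonic_field c 0 $ 1 = harmonic_field c' 0 $ 1" "harmonic_field c 0 $ 2 = harmonic_field c' 0 $ 2"
    unfolding eq by (rule refl)+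
  then show "c = c'"
    unfolding raise_harmonic_field by (simp add: harmonic_field_def vec_eq_iff forall_3)
qed simp

definition int_det_V where "int_det_V = integral {0..\<kappa>} (\<lambda>x. det (V x))"
definition int_a where "int_a j = integral {0..\<kappa>} (\<lambda>x. a x $ j)"

text \<open>The periods of \<open>harmonic_field c\<close>, shown to be so in \<open>path_integral_harmonic_field\<close>.\<close>

definition periods :: "real ^ 3 \<Rightarrow> real ^ 3" where
  "periods c = vector [c $ 1, c $ 2, int_det_V * c $ 3 + int_a 1 * c $ 1 + int_a 2 * c $ 2]"

lemma int_det_V_pos: "int_det_V > 0"
proof -
  have "continuous_on {0..\<kappa>} (\<lambda>x. det (V x))" by (intro smooth_imp_continuous smooth_det_V)
  moreover have "integral {0..\<kappa>} (\<lambda>x. det (V x)) \<ge> 0"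
    using det_V_pos by (intro integral_nonneg integrable_continuous_interval calculation) (simp add: less_imp_le)
  ultimately show ?thesis
    using integral_eq_0_iff[of 0 \<kappa> "\<lambda>x. det (V x)"] det_V_pos[of 0] det_V_pos pos
    unfolding int_det_V_def by (force simp: less_le)
qed

lemma integral_third_period:
  fixes q :: "real \<Rightarrow> real"
  assumes "continuous_on UNIV q"
  shows "integral {0..1} (\<lambda>s. \<kappa> * q (s * \<kappa>)) = integral {0..\<kappa>} q"
proof -
  have "(q has_integral integral {0..\<kappa>} q) (cbox 0 \<kappa>)"
    using assms by (auto intro!: integrable_integral integrable_continuous_interval intro: continuous_on_subset)
  from has_integral_affinity[OF this, of \<kappa> 0]
  have "((\<lambda>s. q (\<kappa> * s)) has_integral integral {0..\<kappa>} q / \<kappa>) {0..1}"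
    using pos by (simp add: image_affinity_cbox)
  from has_integral_mult_right[OF this, of \<kappa>] pos
  have "((\<lambda>s. \<kappa> * q (s * \<kappa>)) has_integral integral {0..\<kappa>} q) {0..1}"
    by (simp add: mult.commute)
  then show ?thesis by (rule integral_unique)
qed

lemma path_integral_harmonic_field:
  "path_integral (cycle \<kappa> i) (covector_form (harmonic_field c)) = periods c $ i"
proof -
  have d: "vector_derivative (cycle \<kappa> i) (at s) = period \<kappa> i" for s
    unfolding cycle_def[abs_def]
    by (rule vector_derivative_at) (auto intro!: derivative_eq_intros)
  have pi: "path_integral (cycle \<kappa> i) (covector_form (harmonic_field c)) =
      integral {0..1} (\<lambda>s. harmonic_field c (s *\<^sub>R period \<kappa> i) $ i * (if i = 3 then \<kappa> else 1))"
    unfolding path_integral_def d covector_form_def cycle_def period_def by (simp add: inner_axis)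
  let ?q = "\<lambda>x. det (V x) * c $ 3 + a x $ 1 * c $ 1 + a x $ 2 * c $ 2"
  have s: "smooth_on UNIV ?q" by (intro smooth_intros smooth_det_V smooth_a)
  consider "i = 1" | "i = 2" | "i = 3" using exhaust_3 by blast
  then show ?thesis
  proof cases
    case 1
    show ?thesis unfolding pi unfolding 1 by (simp add: harmonic_field_def periods_def)
  next
    case 2
    show ?thesis unfolding pi unfolding 2 by (simp add: harmonic_field_def periods_def)
  next
    case 3
    have "integral {0..1} (\<lambda>s. harmonic_field c (s *\<^sub>R period \<kappa> 3) $ 3 * \<kappa>)
       = integral {0..1} (\<lambda>s. \<kappa> * ?q (s * \<kappa>))"
      by (simp add: harmonic_field_def period_def mult.commute axis_def)
    also have "\<dots> = integral {0..\<kappa>} ?q"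
      by (intro integral_third_period smooth_imp_continuous s)
    also have "\<dots> = periods c $ 3"
      by (simp add: periods_def int_det_V_def int_a_def integral_add integrable_continuous_interval
        smooth_imp_continuous smooth_intros smooth_det_V smooth_a)
    finally show ?thesis unfolding pi unfolding 3 by simp
  qed
qed

lemma periods_inject: "periods c = periods c' \<longleftrightarrow> c = c'"
  using int_det_V_pos by (auto simp: periods_def vec_eq_iff forall_3)

text \<open>The solution \<open>c\<close> of \<open>periods c = axis j 1\<close>.\<close>

definition dual_coeff :: "3 \<Rightarrow> real ^ 3" where
  "dual_coeff j = (let e = axis j 1 :: real ^ 3 in
     vector [e $ 1, e $ 2, (e $ 3 - int_a 1 * e $ 1 - int_a 2 * e $ 2) / int_det_V])"

lemma periods_dual_coeff: "periods (dual_coeff j) = axis j 1"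
  using int_det_V_pos by (simp add: periods_def dual_coeff_def Let_def vec_eq_iff forall_3)

lemma periods_sum: "periods (\<Sum>i\<in>UNIV. e $ i *\<^sub>R dual_coeff i) = e"
proof -
  have "periods (\<Sum>i\<in>UNIV. e $ i *\<^sub>R dual_coeff i) = (\<Sum>i\<in>UNIV. e $ i *\<^sub>R periods (dual_coeff i))"
    by (simp add: periods_def sum_3 vec_eq_iff forall_3 algebra_simps)
  then show ?thesis
    using basis_expansion[of e] by (simp add: periods_dual_coeff scalar_mult_eq_scaleR)
qed

definition dual_form :: "3 \<Rightarrow> (real ^ 3, real) form" where
  "dual_form j = covector_form (harmonic_field (dual_coeff j))"

lemma sum_dual_form:
  "(\<lambda>p v. \<Sum>i\<in>UNIV. e $ i * dual_form i p v)
    = covector_form (harmonic_field (\<Sum>i\<in>UNIV. e $ i *\<^sub>R dual_coeff i))"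
  by (intro ext)
    (simp add: dual_form_def covector_form_def harmonic_field_def sum_3 inner_vec_def algebra_simps)

lemma harmonic_basis_dual_form: "harmonic_basis \<kappa> g dual_form"
  unfolding harmonic_basis_def
proof (intro conjI allI impI)
  show "harmonic_1form \<kappa> g (dual_form i)" for i
    by (simp add: dual_form_def harmonic_1form_harmonic_field)
  fix \<eta> assume "harmonic_1form \<kappa> g \<eta>"
  then obtain c where c: "\<eta> = covector_form (harmonic_field c)" by (auto simp: harmonic_1form_iff)
  have "\<eta> = (\<lambda>p v. \<Sum>i\<in>UNIV. e $ i * dual_form i p v) \<longleftrightarrow> e = periods c" for e
    unfolding sum_dual_form c covector_form_inject harmonic_field_inject
    by (metis periods_inject periods_sum)
  then show "\<exists>!e :: real ^ 3. \<eta> = (\<lambda>p v. \<Sum>i\<in>UNIV. e $ i * dual_form i p v)" by simp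
qed

lemma dual_harmonic_basis_eq: "dual_harmonic_basis \<kappa> g = dual_form"
  unfolding dual_harmonic_basis_def
proof (rule the_equality)
  show "harmonic_basis \<kappa> g dual_form \<and> period_matrix \<kappa> dual_form = mat 1"
    by (simp add: harmonic_basis_dual_form)
      (simp add: period_matrix_def dual_form_def path_integral_harmonic_field
      periods_dual_coeff mat_def axis_def vec_eq_iff)
  fix \<theta> assume \<theta>: "harmonic_basis \<kappa> g \<theta> \<and> period_matrix \<kappa> \<theta> = mat 1"
  show "\<theta> = dual_form"
  proof
    fix j
    have "harmonic_1form \<kappa> g (\<theta> j)"
      using \<theta> by (simp add: harmonic_basis_def)
    then obtain c where c: "\<theta> j = covector_form (harmonic_field c)"
      by (auto simp: harmonic_1form_iff)
    have "periods c $ i = axis j 1 $ i" for i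
    proof -
      have "period_matrix \<kappa> \<theta> $ i $ j = mat 1 $ i $ j" using \<theta> by simp
      then show ?thesis
        by (simp add: period_matrix_def c path_integral_harmonic_field mat_def axis_def)
    qed
    then have "periods c = periods (dual_coeff j)"
      by (simp add: periods_dual_coeff vec_eq_iff)
    then show "\<theta> j = dual_form j" by (simp add: periods_inject c dual_form_def)
  qed
qed

text \<open>The connection drops out: the terms with \<open>a\<close> in the covector and those in the dual vector
  cancel, since the coordinates \<open>c\<^sub>1, c\<^sub>2, c\<^sub>3\<close> are adapted to the splitting into orbit directions and
  horizontal direction.\<close>

lemma L2_inner_harmonic_field:
  "L2_inner \<kappa> g (covector_form (harmonic_field c)) (covector_form (harmonic_field c')) =
    integral {0..\<kappa>} (\<lambda>x. V x $ 1 $ 1) * (c $ 1 * c' $ 1)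
    + integral {0..\<kappa>} (\<lambda>x. V x $ 1 $ 2) * (c $ 1 * c' $ 2)
    + integral {0..\<kappa>} (\<lambda>x. V x $ 2 $ 1) * (c $ 2 * c' $ 1)
    + integral {0..\<kappa>} (\<lambda>x. V x $ 2 $ 2) * (c $ 2 * c' $ 2)
    + int_det_V * (c $ 3 * c' $ 3)"
proof -
  let ?q = "\<lambda>x. V x $ 1 $ 1 * (c $ 1 * c' $ 1) + V x $ 1 $ 2 * (c $ 1 * c' $ 2)
    + V x $ 2 $ 1 * (c $ 2 * c' $ 1) + V x $ 2 $ 2 * (c $ 2 * c' $ 2) + det (V x) * (c $ 3 * c' $ 3)"
  have s: "smooth_on UNIV ?q" by (intro smooth_intros smooth_det_V smooth_V)
  have "harmonic_field c p \<bullet> raise (harmonic_field c') p = ?q (p $ 3)" for p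
    unfolding raise_harmonic_field harmonic_field_def
    by (simp add: inner_vec_def sum_3) (simp add: algebra_simps)
  then have "L2_inner \<kappa> g (covector_form (harmonic_field c)) (covector_form (harmonic_field c')) =
      integral (cbox 0 (torus_corner \<kappa>)) (\<lambda>p. ?q (p $ 3))"
    unfolding L2_inner_def hodge_star_covector_form torus_integral_def wedge_covector_flux torus_corner_def
    by (simp add: det_3 axis_def)
  also have "\<dots> = integral {0..\<kappa>} ?q"
    by (intro integral_box_third_coordinate smooth_imp_continuous s)
  also have "\<dots> = integral {0..\<kappa>} (\<lambda>x. V x $ 1 $ 1) * (c $ 1 * c' $ 1)
    + integral {0..\<kappa>} (\<lambda>x. V x $ 1 $ 2) * (c $ 1 * c' $ 2)
    + integral {0..\<kappa>} (\<lambda>x. V x $ 2 $ 1) * (c $ 2 * c' $ 1)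
    + integral {0..\<kappa>} (\<lambda>x. V x $ 2 $ 2) * (c $ 2 * c' $ 2)
    + int_det_V * (c $ 3 * c' $ 3)"
    by (simp only: int_det_V_def integral_add integrable_continuous_interval
        smooth_imp_continuous smooth_intros smooth_det_V smooth_V integral_mult_left)
  finally show ?thesis .
qed

text \<open>In the coordinates \<open>c\<close> the \<open>L\<^sup>2\<close> product is block diagonal, with blocks \<open>\<integral> V\<close> and
  \<open>\<integral> det V\<close>.  The dual basis arises from these coordinates by the inverse of the triangular
  map \<open>periods\<close>, which has determinant \<open>1 / \<integral> det V\<close>.\<close>

lemma harmonic_volume_eq:
  "harmonic_volume \<kappa> g =
     det (\<chi> j k. integral {0..\<kappa>} (\<lambda>x. V x $ j $ k) :: real ^ 2 ^ 2)
     / integral {0..\<kappa>} (\<lambda>x. det (V x))"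
proof -
  \<comment> \<open>In these variables the claim is a polynomial identity up to a factor \<open>int_det_V * r = 1\<close>.\<close>
  define r where "r = 1 / int_det_V"
  define b1 where "b1 = int_a 1 / int_det_V"
  define b2 where "b2 = int_a 2 / int_det_V"
  have dual: "dual_coeff 1 = vector [1, 0, - b1]" "dual_coeff 2 = vector [0, 1, - b2]"
    "dual_coeff 3 = vector [0, 0, r]"
    by (simp_all add: dual_coeff_def axis_def b1_def b2_def r_def)
  define M :: "real ^ 2 ^ 2" where "M = (\<chi> j k. integral {0..\<kappa>} (\<lambda>x. V x $ j $ k))"
  have M: "integral {0..\<kappa>} (\<lambda>x. V x $ j $ k) = M $ j $ k" for j k
    by (simp add: M_def)
  have "harmonic_volume \<kappa> g = int_det_V * r * (r * det M)"
    unfolding harmonic_volume_def Let_def dual_harmonic_basis_eq dual_form_def L2_inner_harmonic_field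
      M det_2 det_3 vec_lambda_beta dual vector_3
    by (simp add: algebra_simps)
  then show ?thesis
    using int_det_V_pos by (simp add: r_def M_def int_det_V_def)
qed

end

section \<open>The metric on the fibres\<close>

lemma sum_permutes_2:
  "(\<Sum>\<pi> | \<pi> permutes {..<2::nat}. F \<pi>) = F id + F (Transposition.transpose 0 1)"
proof -
  have 2: "{..<2::nat} = insert 0 {1}" by auto
  show ?thesis
    unfolding 2
    by (subst sum_over_permutations_insert, simp, simp) (simp add: permutes_sing)
qed

lemma wedge_1_1:
  fixes a b :: "('a::euclidean_space, complex) form"
  assumes "\<And>v. a z v = A (v 0)" "\<And>v. b z v = B (v 0)"
  shows "wedge 1 1 a b z v = A (v 0) * B (v 1) - A (v 1) * B (v 0)"
proof -
  have *: "{..<1 + 1 :: nat} = {..<2}" by simp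
  show ?thesis
    unfolding wedge_def * sum_permutes_2 by (simp add: assms sign_swap_id sign_id)
qed

lemma wedge_2_1:
  fixes a b :: "('a::euclidean_space, complex) form"
  assumes "\<And>v. a z v = A (v 0) * B (v 1) - A (v 1) * B (v 0)" "\<And>v. b z v = C (v 0)"
  shows "wedge 2 1 a b z v = det (vector [vector [A (v 0), B (v 0), C (v 0)],
     vector [A (v 1), B (v 1), C (v 1)], vector [A (v 2), B (v 2), C (v 2)]] :: complex ^ 3 ^ 3)"
proof -
  have *: "{..<2 + 1 :: nat} = {..<3}" by simp
  have sg: "sign (Transposition.transpose 0 1 \<circ> Transposition.transpose 1 (2::nat)) = 1"
    "sign (Transposition.transpose 0 2 \<circ> Transposition.transpose 1 (2::nat)) = 1"
    by (simp_all add: sign_compose sign_swap_id permutation_swap_id)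
  show ?thesis
    unfolding wedge_def * sum_permutes_3
    by (simp add: sg sign_swap_id sign_id assms det_3 Transposition.transpose_def del: One_nat_def)
      (simp add: numeral_2_eq_2 algebra_simps)
qed

text \<open>The real 1-forms \<open>\<beta>\<^sub>j\<close> with \<open>\<theta>\<^sub>j = i \<beta>\<^sub>j\<close>: the terms \<open>\<alpha>\<^sub>j du\<close> and its conjugate combine to
  \<open>2 i Im (\<alpha>\<^sub>j du)\<close>.\<close>

definition connection :: "complex ^ 2 \<Rightarrow> cover \<Rightarrow> real ^ 2" where
  "connection \<alpha> v = (\<chi> j. fst v $ j + 2 * Im (\<alpha> $ j * fst (snd v)))"

lemma theta_eq: "theta \<alpha> j z v = \<i> * of_real (connection (\<alpha> (snd z)) (v 0) $ j)"
  by (simp add: theta_def connection_def d_u_def d_ubar_def d_phi_def complex_eq_iff)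

text \<open>The values of the three \<open>(1,0)\<close>-forms \<open>\<zeta>\<^sub>1, \<zeta>\<^sub>2, du\<close> whose wedge product is \<open>- \<Omega>\<close>.  As a
  map from real tangent vectors to \<open>\<complex>\<^sup>3\<close> it is bijective, and the complex structure of \<open>\<Omega>\<close> is the
  pullback of multiplication by \<open>i\<close>.\<close>

definition complex_coframe :: "real ^ 2 ^ 2 \<Rightarrow> complex ^ 2 \<Rightarrow> cover \<Rightarrow> complex ^ 3" where
  "complex_coframe V \<alpha> v = vector
    [of_real ((V *v snd (snd v)) $ 1) - \<i> * of_real (connection \<alpha> v $ 1),
     of_real ((V *v snd (snd v)) $ 2) - \<i> * of_real (connection \<alpha> v $ 2), fst (snd v)]"

lemma zeta_eq:
  "zeta W \<alpha> 1 z v = complex_coframe (matrix_inv (W (snd z))) (\<alpha> (snd z)) (v 0) $ 1"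
  "zeta W \<alpha> 2 z v = complex_coframe (matrix_inv (W (snd z))) (\<alpha> (snd z)) (v 0) $ 2"
  by (simp_all add: zeta_def complex_coframe_def theta_eq d_t_def matrix_vector_mult_def sum_2)

lemma Omega_form_eq_det:
  "Omega_form W \<alpha> z v = (let Z = complex_coframe (matrix_inv (W (snd z))) (\<alpha> (snd z)) in
     - det (vector [Z (v 0), Z (v 1), Z (v 2)] :: complex ^ 3 ^ 3))"
proof -
  let ?Z = "complex_coframe (matrix_inv (W (snd z))) (\<alpha> (snd z))"
  have u: "d_u z v = ?Z (v 0) $ 3" for v by (simp add: d_u_def complex_coframe_def)
  note w = wedge_1_1[where a = "zeta W \<alpha> 1" and b = "zeta W \<alpha> 2" and z = z
    and A = "\<lambda>v. ?Z v $ 1" and B = "\<lambda>v. ?Z v $ 2", OF zeta_eq]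
  show ?thesis
    unfolding Omega_form_def Let_def
      wedge_2_1[where z = z and a = "wedge 1 1 (zeta W \<alpha> 1) (zeta W \<alpha> 2)" and b = d_u
        and A = "\<lambda>v. ?Z v $ 1" and B = "\<lambda>v. ?Z v $ 2" and C = "\<lambda>v. ?Z v $ 3", OF w u]
    by (simp add: det_3)
qed

text \<open>A vector is determined by its contraction with \<open>\<Omega>\<close>: inserting pairs of vectors from the
  frame \<open>E\<close> dual to the coframe isolates the three components, and the coframe is injective.\<close>

lemma cstruct_Omega_form_eqI:
  fixes W :: "complex \<times> (real ^ 2) \<Rightarrow> real ^ 2 ^ 2" and \<alpha> :: "complex \<times> (real ^ 2) \<Rightarrow> complex ^ 2"
  assumes W: "det (W (snd z)) \<noteq> 0"
  defines "Z \<equiv> complex_coframe (matrix_inv (W (snd z))) (\<alpha> (snd z))"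
  assumes w: "Z w = \<i> *s Z v"
  shows "cstruct (Omega_form W \<alpha>) z v = w"
  unfolding cstruct_def
proof (rule the_equality)
  have Om: "Omega_form W \<alpha> z x = - det (vector [Z (x 0), Z (x 1), Z (x 2)] :: complex ^ 3 ^ 3)" for x
    by (simp add: Omega_form_eq_det Z_def Let_def)
  show "\<forall>x. Omega_form W \<alpha> z (x(0 := w)) = \<i> * Omega_form W \<alpha> z (x(0 := v))"
    by (simp add: Om w det_3) (simp add: algebra_simps)
  fix w' assume w': "\<forall>x. Omega_form W \<alpha> z (x(0 := w')) = \<i> * Omega_form W \<alpha> z (x(0 := v))"
  let ?V = "matrix_inv (W (snd z))"
  have inv: "?V *v (W (snd z) *v e) = e" "W (snd z) *v (?V *v e) = e" for e
    using W by (simp_all add: matrix_vector_mul_assoc matrix_mul_matrix_inv)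
  \<comment> \<open>The third vector is \<open>\<partial>x\<close> corrected by orbit directions so that \<open>\<beta>\<close> vanishes on it.\<close>
  define E :: "3 \<Rightarrow> cover" where "E i = (if i = 3 then (\<chi> j. - 2 * Im (\<alpha> (snd z) $ j), 1, 0)
      else (0, 0, W (snd z) *v (if i = 1 then axis 1 1 else axis 2 1)))" for i
  have E: "Z (E 1) = axis 1 1" "Z (E 2) = axis 2 1" "Z (E 3) = axis 3 1"
    by (simp_all add: Z_def E_def complex_coframe_def connection_def inv vec_eq_iff forall_3 axis_def)
  have eq: "det (vector [Z w', Z e, Z f] :: complex ^ 3 ^ 3)
      = \<i> * det (vector [Z v, Z e, Z f] :: complex ^ 3 ^ 3)" for e f
    using w'[rule_format, of "\<lambda>i. if i = 1 then e else f"] by (simp add: Om)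
  have "Z w' = \<i> *s Z v"
    using eq[of "E 2" "E 3"] eq[of "E 1" "E 3"] eq[of "E 1" "E 2"]
    by (simp add: E det_3 axis_def vec_eq_iff forall_3)
  then have Zeq: "Z w' = Z w" using w by simp
  have u: "fst (snd w') = fst (snd w)"
    using arg_cong[OF Zeq, of "\<lambda>c. c $ 3"] by (simp add: Z_def complex_coframe_def)
  have "(?V *v snd (snd w')) $ j = (?V *v snd (snd w)) $ j \<and>
      connection (\<alpha> (snd z)) w' $ j = connection (\<alpha> (snd z)) w $ j" for j
    using exhaust_2[of j] arg_cong[OF Zeq, of "\<lambda>c. c $ 1"] arg_cong[OF Zeq, of "\<lambda>c. c $ 2"]
    by (auto simp: Z_def complex_coframe_def complex_eq_iff)
  then have c: "?V *v snd (snd w') = ?V *v snd (snd w)"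
    "connection (\<alpha> (snd z)) w' = connection (\<alpha> (snd z)) w"
    by (simp_all add: vec_eq_iff)
  from c(1) have "snd (snd w') = snd (snd w)" by (metis inv(2))
  moreover from c(2) u have "fst w' = fst w" by (simp add: connection_def vec_eq_iff)
  ultimately show "w' = w" using u by (simp add: prod_eq_iff)
qed

text \<open>The complex structure maps the tangent space of a fibre to its normal space: \<open>\<beta>\<close>
  vanishes on the image, \<open>dy\<close> takes over the value of \<open>dx\<close>, and \<open>dt\<close> that of \<open>W \<beta>\<close>.\<close>

lemma cstruct_Omega_form_fibre:
  assumes "det (W (snd z)) \<noteq> 0"
  shows "cstruct (Omega_form W \<alpha>) z (\<nu>, of_real s, 0) =
    (\<chi> j. - 2 * s * Re (\<alpha> (snd z) $ j), \<i> * of_real s,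
     W (snd z) *v connection (\<alpha> (snd z)) (\<nu>, of_real s, 0))"
  using assms
  by (intro cstruct_Omega_form_eqI)
    (simp_all add: complex_coframe_def connection_def vec_eq_iff forall_3 matrix_vector_mul_assoc
      matrix_mul_matrix_inv algebra_simps)

text \<open>On the pair of \<open>v\<close> and \<open>J w\<close> the form \<open>\<omega> = det W\<^sup>-\<^sup>1 dx \<and> dy + \<Sum> \<beta>\<^sub>j \<and> dt\<^sub>j\<close> only sees \<open>dx\<close>
  and \<open>\<beta>\<close> on \<open>v\<close>, and only \<open>dy\<close> and \<open>dt\<close> on \<open>J w\<close>.\<close>

lemma kaehler_metric_fibre:
  assumes "det (W (snd z)) \<noteq> 0"
  shows "kaehler_metric (cstruct (Omega_form W \<alpha>)) (omega_form W \<alpha>) z (\<mu>, of_real r, 0) (\<nu>, of_real s, 0) =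
     det (matrix_inv (W (snd z))) * (r * s) +
     connection (\<alpha> (snd z)) (\<mu>, of_real r, 0) \<bullet> (W (snd z) *v connection (\<alpha> (snd z)) (\<nu>, of_real s, 0))"
proof -
  have 1: "wedge 1 1 d_u d_ubar z v
      = fst (snd (v 0)) * cnj (fst (snd (v 1))) - fst (snd (v 1)) * cnj (fst (snd (v 0)))" for v
    by (rule wedge_1_1) (simp_all add: d_u_def d_ubar_def)
  have 2: "wedge 1 1 (theta \<alpha> j) (d_t j) z v =
      (\<i> * of_real (connection (\<alpha> (snd z)) (v 0) $ j)) * of_real (snd (snd (v 1)) $ j)
      - (\<i> * of_real (connection (\<alpha> (snd z)) (v 1) $ j)) * of_real (snd (snd (v 0)) $ j)" for j v
    by (rule wedge_1_1) (simp_all add: theta_eq d_t_def)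
  show ?thesis
    unfolding kaehler_metric_def cstruct_Omega_form_fibre[where W = W and z = z, OF assms] omega_form_def 1 2
    by (simp add: inner_vec_def sum_2 algebra_simps)
qed

lemma frechet_derivative_fibre_chart:
  "frechet_derivative (fibre_chart b) (at p) v = (vector [v $ 1, v $ 2], of_real (v $ 3), 0)"
proof -
  let ?L = "\<lambda>v :: real ^ 3. (vector [v $ 1, v $ 2], of_real (v $ 3), 0) :: cover"
  have "linear ?L"
    by (intro linearI) (auto simp: vec_eq_iff forall_2 complex_eq_iff)
  then have "(?L has_derivative ?L) (at p)"
    by (simp add: linear_conv_bounded_linear bounded_linear_imp_has_derivative)
  then have "((\<lambda>p. ?L p + (0, Complex 0 (snd b), fst b)) has_derivative ?L) (at p)"
    by (rule has_derivative_add[OF _ has_derivative_const, THEN has_derivative_eq_rhs]) simp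
  moreover have "(\<lambda>p. ?L p + (0, Complex 0 (snd b), fst b)) = fibre_chart b"
    by (intro ext) (simp add: fibre_chart_def complex_eq_iff)
  ultimately have "(fibre_chart b has_derivative ?L) (at p)" by (simp only:)
  then show ?thesis by (rule fun_cong[OF frechet_derivative_at[symmetric]])
qed

theorem corollary1:
  fixes B :: "((real ^ 2) \<times> real) set"
    and W :: "complex \<times> (real ^ 2) \<Rightarrow> real ^ 2 ^ 2"
    and \<alpha> :: "complex \<times> (real ^ 2) \<Rightarrow> complex ^ 2"
    and \<kappa> :: real
    and t :: "real ^ 2" and y :: real
  assumes "open B"
    and "\<kappa> > 0"
    and "smooth_on (data_domain B) W"
    and "smooth_on (data_domain B) \<alpha>"
    and "\<forall>p \<in> data_domain B. transpose (W p) = W p"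
    and "\<forall>p \<in> data_domain B. \<forall>v. v \<noteq> 0 \<longrightarrow> v \<bullet> (W p *v v) > 0"
    and "\<forall>(u, s) \<in> data_domain B. W (u + of_real \<kappa>, s) = W (u, s)"
    and "\<forall>(u, s) \<in> data_domain B. \<alpha> (u + of_real \<kappa>, s) = \<alpha> (u, s)"
    and "calabi_yau (total_space B) (Omega_form W \<alpha>) (omega_form W \<alpha>)"
    and "(t, y) \<in> B"
  shows "semi_flat_volumes W \<alpha> \<kappa> (t, y) =
           det (\<chi> j k. integral {0..\<kappa>} (\<lambda>x. matrix_inv (W (Complex x y, t)) $ j $ k) :: real ^ 2 ^ 2)
           / integral {0..\<kappa>} (\<lambda>x. det (matrix_inv (W (Complex x y, t))))"
proof -
  let ?g = "pullback_metric (fibre_chart (t, y))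
    (kaehler_metric (cstruct (Omega_form W \<alpha>)) (omega_form W \<alpha>))"
  let ?W = "\<lambda>x. W (Complex x y, t)"
  let ?a = "\<lambda>x. \<chi> j. 2 * Im (\<alpha> (Complex x y, t) $ j)"
  have dom: "(Complex x y, t) \<in> data_domain B" for x
    using assms(10) by (simp add: data_domain_def)
  have line: "of_real x + Complex 0 y = Complex x y" for x
    by (simp add: complex_eq_iff)
  have lin: "bounded_linear (\<lambda>x. (of_real x, 0) :: complex \<times> (real ^ 2))"
    by (intro bounded_linear_Pair bounded_linear_of_real bounded_linear_zero)
  have det_nonzero: "det (?W x) \<noteq> 0" for x
  proof -
    have "?W x *v e \<noteq> 0" if "e \<noteq> 0" for e
      using assms(6) dom[of x] that by (metis inner_zero_right less_irrefl)
    then have "inj ((*v) (?W x))"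
      by (metis linear_injective_0 matrix_vector_mul_linear)
    then show ?thesis
      by (metis inj_matrix_vector_mult invertible_det_nz invertible_left_inverse matrix_left_invertible_injective)
  qed
  interpret fibre_metric \<kappa> ?g ?W ?a
  proof
    show "\<kappa> > 0" by fact
    show "smooth_on UNIV (\<lambda>x. ?W x $ i $ j)" for i j
      using smooth_affine[OF _ lin _ assms(3), of "\<lambda>M. M $ i $ j" "(Complex 0 y, t)"]
      by (simp add: line dom bounded_linear_compose[OF bounded_linear_vec_nth bounded_linear_vec_nth])
    have "bounded_linear (\<lambda>c :: complex ^ 2. 2 * Im (c $ i))" for i
      by (intro bounded_linear_const_mult bounded_linear_compose[OF bounded_linear_Im bounded_linear_vec_nth])
    from smooth_affine[OF this lin _ assms(4), of "(Complex 0 y, t)"]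
    show "smooth_on UNIV (\<lambda>x. ?a x $ i)" for i
      by (simp add: line dom)
    have shift: "Complex (x + \<kappa>) y = Complex x y + of_real \<kappa>" for x
      by (simp add: complex_eq_iff)
    show "?W (x + \<kappa>) = ?W x" for x using assms(7) dom[of x] by (auto simp: shift)
    show "?a (x + \<kappa>) = ?a x" for x using assms(8) dom[of x] by (auto simp: shift)
    show "transpose (?W x) = ?W x" for x using assms(5) dom by blast
    show "e \<bullet> (?W x *v e) > 0" if "e \<noteq> 0" for e x using assms(6) dom that by blast
    fix p v w :: "real ^ 3"
    have z: "snd (fibre_chart (t, y) p) = (Complex (p $ 3) y, t)" by (simp add: fibre_chart_def)
    have conn: "connection (\<alpha> (Complex (p $ 3) y, t)) (vector [v $ 1, v $ 2], of_real (v $ 3), 0) =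
        vector [v $ 1 + ?a (p $ 3) $ 1 * v $ 3, v $ 2 + ?a (p $ 3) $ 2 * v $ 3]" for v :: "real ^ 3"
      by (simp add: connection_def vec_eq_iff forall_2)
    show "?g p v w = det (matrix_inv (?W (p $ 3))) * (v $ 3 * w $ 3) +
      vector [v $ 1 + ?a (p $ 3) $ 1 * v $ 3, v $ 2 + ?a (p $ 3) $ 2 * v $ 3] \<bullet>
        (?W (p $ 3) *v vector [w $ 1 + ?a (p $ 3) $ 1 * w $ 3, w $ 2 + ?a (p $ 3) $ 2 * w $ 3])"
      unfolding pullback_metric_def frechet_derivative_fibre_chart
      by (subst kaehler_metric_fibre) (simp_all only: z conn det_nonzero not_False_eq_True)
  qed
  show ?thesis
    unfolding semi_flat_volumes_def harmonic_volume_eq V_def ..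
qed

end
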